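(* Let $D$ be an integrally closed local integral domain, and suppose there exists a set $\Delta\subseteq\operatorname{Spec}(D)$ of (pairwise) incomparable nonzero prime ideals such that $\bigcap\{P\mid P\in\Delta\}=(0)$. Then $|\mathcal{K}(D)|\in\{1,\infty\}$, i.e., $\mathcal{K}(D)$ is either a singleton or infinite.
   Context: "Local" means having a unique maximal ideal (not necessarily Noetherian). For an integral domain $D$ with quotient field $K$, $\operatorname{Zar}(D)$ is the set of all valuation rings $V$ with $D\subseteq V\subseteq K$ and quotient field $K$ (including $K$ itself). For $V\in\operatorname{Zar}(D)$ with maximal ideal $\mathfrak{m}_V$, let $V(X):=V[X]_{\mathfrak{m}_V[X]}\subseteq K(X)$, where $X$ is an indeterminate. For nonempty $\Lambda\subseteq\operatorname{Zar}(D)$, the Kronecker function ring of $D$ with respect to $\Lambda$ is $\operatorname{Kr}(D,\Lambda):=\bigcap\{V(X)\mid V\in\Lambda\}$. $\mathcal{K}(D)$ denotes the set of all Kronecker function rings $T$ of $D$ (rings of the form $T=\operatorname{Kr}(D,\Lambda)$) such that $T\cap K=D$. *)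

theory Defs
  imports "HOL-Algebra.Algebraic_Closure_Type"
begin

(* The quotient field K is the type 'k, all rings between D and K are subsets of 'k, and
   K(X) is the type 'k poly fract. HOL-Algebra's notions are applied to a subset A of K
   through the following record. *)

abbreviation ring_on :: "'k::field set \<Rightarrow> 'k ring" where
  "ring_on A \<equiv> ring_of_type_algebra\<lparr>carrier := A\<rparr>"

abbreviation subring_of_field :: "'k::field set \<Rightarrow> bool" where
  "subring_of_field A \<equiv> subring A ring_of_type_algebra"

definition quotient_field :: "'k::field set \<Rightarrow> 'k set" where
  "quotient_field A = {a / b | a b. a \<in> A \<and> b \<in> A \<and> b \<noteq> 0}"

definition Spec :: "'k::field set \<Rightarrow> 'k set set" where
  "Spec A = {P. primeideal P (ring_on A)}"

definition local_ring :: "'k::field set \<Rightarrow> bool" where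
  "local_ring A \<longleftrightarrow> (\<exists>!M. maximalideal M (ring_on A))"

definition the_maximal_ideal :: "'k::field set \<Rightarrow> 'k set" where
  "the_maximal_ideal A = (THE M. maximalideal M (ring_on A))"

definition polys_over :: "'k::field set \<Rightarrow> 'k poly set" where
  "polys_over S = {p. \<forall>i. Polynomial.coeff p i \<in> S}"

definition integrally_closed :: "'k::field set \<Rightarrow> bool" where
  "integrally_closed A \<longleftrightarrow>
     (\<forall>x \<in> quotient_field A.
        (\<exists>p \<in> polys_over A. Polynomial.lead_coeff p = 1 \<and> poly p x = 0) \<longrightarrow> x \<in> A)"

definition valuation_ring :: "'k::field set \<Rightarrow> bool" where
  "valuation_ring V \<longleftrightarrow>
     subring_of_field V \<and> (\<forall>x \<in> quotient_field V. x \<noteq> 0 \<longrightarrow> x \<in> V \<or> inverse x \<in> V)"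

definition Zar :: "'k::field set \<Rightarrow> 'k set set" where
  "Zar D = {V. valuation_ring V \<and> D \<subseteq> V \<and> quotient_field V = UNIV}"

(* V(X), the localization of V[X] at m[X], where m is the maximal ideal of V: the extension
   of m to V[X] consists of the polynomials with all coefficients in m. *)

definition rational_ext :: "'k::field set \<Rightarrow> 'k poly fract set" where
  "rational_ext V =
     {Fract f g | f g. f \<in> polys_over V \<and> g \<in> polys_over V - polys_over (the_maximal_ideal V)}"

(* The base ring D enters only through the requirement that \<Lambda> is a nonempty subset of Zar D. *)

definition Kr :: "'k::field set set \<Rightarrow> 'k poly fract set" where
  "Kr \<Lambda> = (\<Inter>V\<in>\<Lambda>. rational_ext V)"

definition const_fract :: "'k::field \<Rightarrow> 'k poly fract" where
  "const_fract c = to_fract [:c:]"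

definition Kronecker_rings :: "'k::field set \<Rightarrow> 'k poly fract set set" where
  "Kronecker_rings D =
     {T. (\<exists>\<Lambda>. \<Lambda> \<noteq> {} \<and> \<Lambda> \<subseteq> Zar D \<and> T = Kr \<Lambda>) \<and> T \<inter> range const_fract = const_fract ` D}"

end

theory Submission
  imports Defs
begin

text \<open>
  Since \<open>V(X) \<inter> K = V\<close>, the ring \<open>Kr \<Lambda>\<close> meets \<open>K\<close> in the intersection of \<open>\<Lambda>\<close>, so \<open>K(D)\<close> consists of the
  rings \<open>Kr \<Lambda>\<close> with \<open>\<Inter>\<Lambda> = D\<close>. As \<open>D\<close> is integrally closed, \<open>Kr (Zar D)\<close> is one of them, and the smallest.
  Suppose that there is another one but that there are only finitely many. Some \<open>\<phi> \<in> K(X)\<close> lies in this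
  other ring and not in \<open>Kr (Zar D)\<close>. Let \<open>L\<close> be the set of all \<open>W \<in> Zar D\<close> with \<open>\<phi> \<in> W(X)\<close>; still
  \<open>\<Inter>L = D\<close>. Adding single points of the complement \<open>\<Gamma>\<close> of \<open>L\<close> to \<open>L\<close> produces pairwise different members of
  \<open>K(D)\<close>, so \<open>\<Gamma>\<close> is finite. A minimal element \<open>V\<close> of \<open>\<Gamma>\<close> is then an isolated point of \<open>Zar D\<close> in the strong
  sense that for a finite subset \<open>S\<close> of its maximal ideal it is the only ring in \<open>Zar D\<close> whose maximal ideal
  contains \<open>S\<close>.

  The heart of the proof is that for such a point there is an element \<open>f\<close> of \<open>K\<close> that belongs to every ring
  in \<open>Zar D\<close> except \<open>V\<close> (lemma \<open>separating_element_of_minimal_isolated_point\<close>). This is absurd: \<open>f\<close> would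
  belong to \<open>\<Inter>L = D \<subseteq> V\<close>.

  To find \<open>f\<close>, think of elements of \<open>K\<close> as functions on \<open>Zar D\<close>: \<open>f\<close> is regular at \<open>W\<close> if \<open>f \<in> W\<close>, has a
  pole at \<open>W\<close> otherwise, and \<open>1 / f\<close> is in the maximal ideal of \<open>W\<close> exactly at the poles of \<open>f\<close>. One wants
  a function with a pole at \<open>V\<close> and nowhere else. An element \<open>u \<in> S\<close> of least value provides \<open>1 / u\<close> with a
  pole at \<open>V\<close>, and the point \<open>V\<close> is open and closed in the set of all poles of \<open>1 / u\<close>. Lemma
  \<open>separating_element_of_closed_set\<close> reduces this situation to the one of lemma \<open>separating_element\<close>, where the
  poles of \<open>1 / u\<close> are split into two parts by the behaviour of a single element \<open>x\<close>. There one writes down a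
  function \<open>h\<close>, integral over \<open>D[u]\<close>, that is \<open>1\<close> modulo \<open>u\<close> on one part and divisible by \<open>u\<close> on the other.
  The powers of \<open>h / u\<close> have only the wanted poles, except where \<open>u\<close> itself has a pole. Modulo functions that
  do no harm they lie in a finitely generated module over a finitely generated subring of \<open>D\<close>. Such rings are
  Noetherian, so a suitable combination of the powers is free of the superfluous poles.
\<close>

section \<open>Subrings of a field\<close>

lemma subring_of_field_iff:
  "subring_of_field A \<longleftrightarrow> 1 \<in> A \<and> (\<forall>x\<in>A. \<forall>y\<in>A. x - y \<in> A \<and> x * y \<in> A)"
proof
  interpret R: cring "ring_of_type_algebra :: 'a ring" by (rule cring_from_type_algebra)
  have ainv: "\<ominus>\<^bsub>ring_of_type_algebra\<^esub> h = - h" for h :: 'a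
    by (rule R.minus_equality) (auto simp: ring_of_type_algebra_def)
  {
    assume A: "subring_of_field A"
    have "x - y \<in> A" if "x \<in> A" "y \<in> A" for x y
      using subringE(7)[OF A that(1) subringE(5)[OF A that(2)]]
      by (simp add: ainv) (simp add: ring_of_type_algebra_def)
    then show "1 \<in> A \<and> (\<forall>x\<in>A. \<forall>y\<in>A. x - y \<in> A \<and> x * y \<in> A)"
      using subringE(3)[OF A] subringE(6)[OF A] by (auto simp: ring_of_type_algebra_def)
  }
  assume A: "1 \<in> A \<and> (\<forall>x\<in>A. \<forall>y\<in>A. x - y \<in> A \<and> x * y \<in> A)"
  then have 0: "0 \<in> A" by (metis diff_self)
  then have neg: "- y \<in> A" if "y \<in> A" for y using A that by (metis diff_0)
  have add: "x + y \<in> A" if "x \<in> A" "y \<in> A" for x y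
    using A neg[OF that(2)] that by (metis diff_minus_eq_add)
  show "subring_of_field A"
    using A neg add by (intro R.subringI) (auto simp: ainv, auto simp: ring_of_type_algebra_def)
qed

context
  fixes A :: "'k::field set"
  assumes A: "subring_of_field A"
begin

lemma subring_one: "1 \<in> A"
  and subring_diff: "x \<in> A \<Longrightarrow> y \<in> A \<Longrightarrow> x - y \<in> A"
  and subring_mult: "x \<in> A \<Longrightarrow> y \<in> A \<Longrightarrow> x * y \<in> A"
  using A by (auto simp: subring_of_field_iff)

lemma subring_zero: "0 \<in> A"
  using subring_diff[OF subring_one subring_one] by simp

lemma subring_uminus: "x \<in> A \<Longrightarrow> - x \<in> A"
  using subring_diff[OF subring_zero] by force

lemma subring_add: "x \<in> A \<Longrightarrow> y \<in> A \<Longrightarrow> x + y \<in> A"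
  using subring_diff[of x "- y"] subring_uminus by force

lemma subring_sum: "(\<And>i. i \<in> I \<Longrightarrow> x i \<in> A) \<Longrightarrow> sum x I \<in> A"
  by (induction I rule: infinite_finite_induct) (auto intro: subring_zero subring_add)

lemma subring_power: "x \<in> A \<Longrightarrow> x ^ n \<in> A"
  by (induction n) (auto intro: subring_one subring_mult)

lemmas subring_closed =
  subring_one subring_diff subring_mult subring_zero subring_uminus subring_add subring_sum
  subring_power

lemma poly_in_subring: "p \<in> polys_over A \<Longrightarrow> x \<in> A \<Longrightarrow> poly p x \<in> A"
  unfolding poly_altdef polys_over_def by (intro subring_closed) auto

lemma polys_over_pCons_iff: "pCons a p \<in> polys_over A \<longleftrightarrow> a \<in> A \<and> p \<in> polys_over A"
proof -
  have "(\<forall>i. Polynomial.coeff (pCons a p) i \<in> A)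
      \<longleftrightarrow> Polynomial.coeff (pCons a p) 0 \<in> A \<and> (\<forall>i. Polynomial.coeff (pCons a p) (Suc i) \<in> A)"
    by (metis not0_implies_Suc)
  then show ?thesis by (auto simp: polys_over_def)
qed

lemma polys_over_zero: "0 \<in> polys_over A"
  and polys_over_add: "p \<in> polys_over A \<Longrightarrow> q \<in> polys_over A \<Longrightarrow> p + q \<in> polys_over A"
  and polys_over_diff: "p \<in> polys_over A \<Longrightarrow> q \<in> polys_over A \<Longrightarrow> p - q \<in> polys_over A"
  and polys_over_monom: "a \<in> A \<Longrightarrow> Polynomial.monom a n \<in> polys_over A"
  by (auto simp: polys_over_def intro: subring_closed)

lemma polys_over_one: "1 \<in> polys_over A"
  using polys_over_monom[OF subring_one, of 0] by (simp add: monom_eq_1)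

lemma polys_over_mult: "p \<in> polys_over A \<Longrightarrow> q \<in> polys_over A \<Longrightarrow> p * q \<in> polys_over A"
  by (auto simp: polys_over_def Polynomial.coeff_mult intro!: subring_closed)

lemma polys_over_sum: "(\<And>i. i \<in> I \<Longrightarrow> p i \<in> polys_over A) \<Longrightarrow> sum p I \<in> polys_over A"
  by (induction I rule: infinite_finite_induct) (auto intro: polys_over_zero polys_over_add)

end

lemma polys_over_mono: "A \<subseteq> B \<Longrightarrow> polys_over A \<subseteq> polys_over B"
  by (auto simp: polys_over_def)

text \<open>
  The inductive form makes it evident that an element involves only finitely many generators, which
  is how the argument passes from \<open>D\<close> to a Noetherian subring.
\<close>
inductive_set ring_hull :: "'k::field set \<Rightarrow> 'k set" for S where
  base: "x \<in> S \<Longrightarrow> x \<in> ring_hull S"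
| one: "1 \<in> ring_hull S"
| diff: "x \<in> ring_hull S \<Longrightarrow> y \<in> ring_hull S \<Longrightarrow> x - y \<in> ring_hull S"
| mult: "x \<in> ring_hull S \<Longrightarrow> y \<in> ring_hull S \<Longrightarrow> x * y \<in> ring_hull S"

lemma subring_ring_hull: "subring_of_field (ring_hull S)"
  by (auto simp: subring_of_field_iff intro: ring_hull.intros)

lemma ring_hull_superset: "S \<subseteq> ring_hull S"
  by (auto intro: ring_hull.base)

lemma ring_hull_least: "subring_of_field A \<Longrightarrow> S \<subseteq> A \<Longrightarrow> ring_hull S \<subseteq> A"
proof
  fix x assume "subring_of_field A" "S \<subseteq> A" "x \<in> ring_hull S"
  from this(3) show "x \<in> A"
    using \<open>S \<subseteq> A\<close> by induction (auto intro: subring_closed[OF \<open>subring_of_field A\<close>])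
qed

lemma ring_hull_mono: "S \<subseteq> T \<Longrightarrow> ring_hull S \<subseteq> ring_hull T"
  by (meson ring_hull_least ring_hull_superset subring_ring_hull subset_trans)

lemma ring_hull_finitary:
  assumes "z \<in> ring_hull (S \<union> T)"
  shows "\<exists>F. finite F \<and> F \<subseteq> S \<and> z \<in> ring_hull (F \<union> T)"
  using assms
proof induction
  case (base x)
  show ?case
  proof (cases "x \<in> T")
    case True
    then show ?thesis by (intro exI[of _ "{}"]) (auto intro: ring_hull.base)
  next
    case False
    then show ?thesis using base by (intro exI[of _ "{x}"]) (auto intro: ring_hull.base)
  qed
next
  case one
  show ?case by (intro exI[of _ "{}"]) (auto intro: ring_hull.one)
next
  case (diff x y)
  then obtain F G where "finite F" "F \<subseteq> S" "x \<in> ring_hull (F \<union> T)"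
    "finite G" "G \<subseteq> S" "y \<in> ring_hull (G \<union> T)" by blast
  moreover have "ring_hull (F \<union> T) \<subseteq> ring_hull ((F \<union> G) \<union> T)" 
    "ring_hull (G \<union> T) \<subseteq> ring_hull ((F \<union> G) \<union> T)"
    by (auto intro!: ring_hull_mono)
  ultimately show ?case by (intro exI[of _ "F \<union> G"]) (auto intro: ring_hull.diff)
next
  case (mult x y)
  then obtain F G where "finite F" "F \<subseteq> S" "x \<in> ring_hull (F \<union> T)"
    "finite G" "G \<subseteq> S" "y \<in> ring_hull (G \<union> T)" by blast
  moreover have "ring_hull (F \<union> T) \<subseteq> ring_hull ((F \<union> G) \<union> T)" 
    "ring_hull (G \<union> T) \<subseteq> ring_hull ((F \<union> G) \<union> T)"
    by (auto intro!: ring_hull_mono)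
  ultimately show ?case by (intro exI[of _ "F \<union> G"]) (auto intro: ring_hull.mult)
qed

lemma ring_hull_insert:
  assumes A: "subring_of_field A"
  shows "ring_hull (insert z A) = (\<lambda>p. poly p z) ` polys_over A"
proof
  have "poly p z \<in> ring_hull (insert z A)" if "p \<in> polys_over A" for p
    using polys_over_mono[OF subset_trans[OF subset_insertI ring_hull_superset[of "insert z A"]]] that
    by (intro poly_in_subring subring_ring_hull) (auto intro: ring_hull.base)
  then show "(\<lambda>p. poly p z) ` polys_over A \<subseteq> ring_hull (insert z A)" by blast
  have 1: "poly p z - poly q z \<in> (\<lambda>p. poly p z) ` polys_over A"
      "poly p z * poly q z \<in> (\<lambda>p. poly p z) ` polys_over A"
    if "p \<in> polys_over A" "q \<in> polys_over A" for p q
    using polys_over_diff[OF A that] polys_over_mult[OF A that]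
    by (metis imageI poly_diff, metis imageI poly_mult)
  have "subring_of_field ((\<lambda>p. poly p z) ` polys_over A)"
    unfolding subring_of_field_iff using 1 polys_over_one[OF A] by (force simp: image_iff)
  moreover have "insert z A \<subseteq> (\<lambda>p. poly p z) ` polys_over A"
  proof -
    have "z = poly [:0, 1:] z" "[:0, 1:] \<in> polys_over A"
      using A by (auto simp: polys_over_pCons_iff polys_over_zero intro: subring_closed)
    moreover have "a = poly [:a:] z" "[:a:] \<in> polys_over A" if "a \<in> A" for a
      using A that by (auto simp: polys_over_pCons_iff polys_over_zero)
    ultimately show ?thesis by blast
  qed
  ultimately show "ring_hull (insert z A) \<subseteq> (\<lambda>p. poly p z) ` polys_over A"
    by (rule ring_hull_least)
qed

section \<open>Valuation rings and integrality\<close>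

text \<open>
  A subring that contains \<open>x\<close> or \<open>1 / x\<close> for every \<open>x \<in> K\<close> has quotient field \<open>K\<close>, so this
  condition alone replaces the two clauses in the definition of \<open>Zar\<close>. With \<open>inverse 0 = 0\<close> it also
  covers \<open>x = 0\<close>. For \<open>x \<noteq> 0\<close>, \<open>inverse x \<notin> W\<close> says that \<open>x\<close> lies in the maximal ideal of \<open>W\<close>;
  the whole development speaks of maximal ideals in this way.
\<close>
lemma Zar_iff:
  "V \<in> Zar D \<longleftrightarrow> subring_of_field V \<and> D \<subseteq> V \<and> (\<forall>x. x \<in> V \<or> inverse x \<in> V)"
proof
  assume "V \<in> Zar D"
  then show "subring_of_field V \<and> D \<subseteq> V \<and> (\<forall>x. x \<in> V \<or> inverse x \<in> V)"
    using subring_zero[of V] unfolding Zar_def valuation_ring_def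
    by (metis (mono_tags, lifting) UNIV_I mem_Collect_eq)
next
  assume V: "subring_of_field V \<and> D \<subseteq> V \<and> (\<forall>x. x \<in> V \<or> inverse x \<in> V)"
  have "x \<in> quotient_field V" for x
  proof (cases "x \<in> V")
    case True
    then show ?thesis using V subring_one[of V] unfolding quotient_field_def
      by (intro CollectI exI[of _ x] exI[of _ 1]) auto
  next
    case False
    then have "inverse x \<in> V" "x \<noteq> 0" using V subring_zero by auto
    moreover from this have "x = 1 / inverse x" "1 \<in> V" "inverse x \<noteq> 0" using V subring_one[of V] by (auto simp: divide_inverse)
    ultimately show ?thesis unfolding quotient_field_def by blast
  qed
  then show "V \<in> Zar D" using V by (auto simp: Zar_def valuation_ring_def)
qed

lemma Zar_subring: "V \<in> Zar D \<Longrightarrow> subring_of_field V"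
  and Zar_superset: "V \<in> Zar D \<Longrightarrow> D \<subseteq> V"
  and Zar_total: "V \<in> Zar D \<Longrightarrow> x \<notin> V \<Longrightarrow> inverse x \<in> V"
  by (auto simp: Zar_iff)

lemma Zar_antimono: "D \<subseteq> E \<Longrightarrow> Zar E \<subseteq> Zar D"
  by (meson Zar_iff subsetI subset_trans)

text \<open>
  The classical step in the existence proof for valuation rings: if \<open>1 / z\<close> lies in both \<open>S[x]\<close> and
  \<open>S[1 / x]\<close>, one uses the relation of smaller degree to eliminate the leading term of the other.
  Since \<open>1\<close> plus a multiple of \<open>z\<close> is a unit of \<open>S\<close>, the constant term can be absorbed first, and
  the degree really drops.
\<close>
lemma no_two_sided_relation:
  assumes S: "subring_of_field S" and z: "z \<in> S" "inverse z \<notin> S"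
    and unit: "\<And>s. s \<in> S \<Longrightarrow> inverse (1 - z * s) \<in> S"
    and "p \<in> polys_over S" "q \<in> polys_over S"
    and "poly p x * z = 1" "poly q (inverse x) * z = 1" "x \<noteq> 0"
  shows False
  using assms(5-)
proof (induction "Polynomial.degree p + Polynomial.degree q" arbitrary: p q x rule: less_induct)
  case less
  note cl = subring_closed[OF S]
  have "z \<noteq> 0" using z cl(4) by auto
  have reduce: False
    if p: "p \<in> polys_over S" and q: "q \<in> polys_over S"
      and px: "poly p x * z = 1" and qx: "poly q (inverse x) * z = 1" and "x \<noteq> 0"
      and le: "Polynomial.degree q \<le> Polynomial.degree p"
      and IH: "\<And>p'. Polynomial.degree p' < Polynomial.degree p \<Longrightarrow> p' \<in> polys_over S
                 \<Longrightarrow> poly p' x * z = 1 \<Longrightarrow> False"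
    for p q x
  proof -
    obtain q0 q1 where q01: "q = pCons q0 q1" by (cases q)
    then have q0: "q0 \<in> S" and q1: "q1 \<in> polys_over S" using q S by (auto simp: polys_over_pCons_iff)
    define n where "n = Polynomial.degree p"
    define m where "m = Polynomial.degree q"
    define e where "e = inverse (1 - z * q0)"
    have ne: "1 - z * q0 \<noteq> 0"
      using z q0 by (metis eq_iff_diff_eq_0 inverse_unique)
    then have e: "e \<in> S" "e * (1 - z * q0) = 1" using unit q0 by (auto simp: e_def)
    have "q1 \<noteq> 0"
      using qx ne by (auto simp: q01 algebra_simps)
    then have m: "m = Suc (Polynomial.degree q1)" by (simp add: m_def q01)
    then have n: "m \<le> n" "0 < n" using le by (auto simp: n_def m_def)
    have one: "e * z * (inverse x * poly q1 (inverse x)) = 1"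
      using qx e(2) by (simp add: q01) (metis (no_types, lifting) add_diff_cancel_left' mult.assoc
        mult.commute distrib_left)
    define lc where "lc = Polynomial.lead_coeff p"
    have lc: "lc \<in> S" using p by (simp add: lc_def polys_over_def)
    define r where "r = Polynomial.monom (lc * z * e) (n - m) * reflect_poly q1"
    define p' where "p' = p - Polynomial.monom lc n + r"
    have "reflect_poly q1 \<in> polys_over S"
      using q1 cl(4) by (auto simp: polys_over_def coeff_reflect_poly)
    then have p'S: "p' \<in> polys_over S" unfolding p'_def r_def using p lc z e
      by (intro polys_over_add polys_over_diff polys_over_mult polys_over_monom S cl)
    have "poly r x = lc * (z * e) * (x ^ (n - m) * x ^ Polynomial.degree q1 * poly q1 (inverse x))"
      using \<open>x \<noteq> 0\<close> by (simp add: r_def poly_monom poly_reflect_poly_nz)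
    also have "x ^ (n - m) * x ^ Polynomial.degree q1 = x ^ n * inverse x"
    proof -
      have "n = Suc (n - m + Polynomial.degree q1)" using n m by simp
      then have "x ^ n = x * (x ^ (n - m) * x ^ Polynomial.degree q1)" by (metis power_Suc power_add)
      then show ?thesis using \<open>x \<noteq> 0\<close> by simp
    qed
    finally have "poly r x = lc * x ^ n * (e * z * (inverse x * poly q1 (inverse x)))"
      by (simp add: mult_ac)
    then have "poly r x = lc * x ^ n" by (simp add: one)
    then have "poly p' x * z = 1" using px by (simp add: p'_def poly_monom)
    moreover have "Polynomial.degree p' < Polynomial.degree p"
    proof -
      have "Polynomial.degree r \<le> (n - m) + Polynomial.degree q1"
        unfolding r_def by (rule order_trans[OF Polynomial.degree_mult_le])
          (intro add_mono degree_monom_le degree_reflect_poly_le)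
      then have r: "Polynomial.degree r < n" using n m by simp
      have "Polynomial.degree p' \<le> n"
        unfolding p'_def using r degree_monom_le[of lc n]
        by (intro Polynomial.degree_add_le Polynomial.degree_diff_le) (auto simp: n_def)
      moreover have "Polynomial.coeff p' n = 0"
        using r by (simp add: p'_def lc_def n_def Polynomial.coeff_eq_0)
      ultimately show ?thesis
        using n(2) eq_zero_or_degree_less[of p' n] by (auto simp: n_def)
    qed
    ultimately show False using IH p'S by blast
  qed
  show False
  proof (cases "Polynomial.degree q \<le> Polynomial.degree p")
    case True
    show False
    proof (rule reduce[of p q x])
      fix p' assume "Polynomial.degree p' < Polynomial.degree p" "p' \<in> polys_over S"
        "poly p' x * z = 1"
      then show False using less.hyps[of p' q x] less.prems by auto
    qed (use less True in auto)
  next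
    case False
    show False
    proof (rule reduce[of q p "inverse x"])
      fix q' assume "Polynomial.degree q' < Polynomial.degree q" "q' \<in> polys_over S"
        "poly q' (inverse x) * z = 1"
      then show False using less.hyps[of p q' x] less.prems by auto
    qed (use less False in auto)
  qed
qed

text \<open>
  Chevalley's extension theorem for a principal ideal: if \<open>1 / t\<close> is an element of \<open>B\<close> but not a unit,
  some valuation ring over \<open>B\<close> has \<open>1 / t\<close> in its maximal ideal. A subring maximal among those that
  avoid \<open>t\<close> does it.
\<close>
lemma valuation_avoiding:
  assumes B: "subring_of_field B" and t: "inverse t \<in> B" "t \<notin> B"
  shows "\<exists>V\<in>Zar B. t \<notin> V"
proof -
  define \<S> where "\<S> = {S. subring_of_field S \<and> B \<subseteq> S \<and> t \<notin> S}"
  have "\<exists>S\<in>\<S>. \<forall>R\<in>\<S>. S \<subseteq> R \<longrightarrow> R = S"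
  proof (rule subset_Zorn_nonempty)
    show "\<S> \<noteq> {}" using B t by (auto simp: \<S>_def)
    fix \<C> assume \<C>: "\<C> \<noteq> {}" "subset.chain \<S> \<C>"
    have "\<exists>Y\<in>\<C>. x \<in> Y \<and> y \<in> Y" if "x \<in> \<Union>\<C>" "y \<in> \<Union>\<C>" for x y
      using that \<C>(2) unfolding subset_chain_def by blast
    moreover have "subring_of_field Y" "B \<subseteq> Y" "t \<notin> Y" if "Y \<in> \<C>" for Y
      using that \<C>(2) by (auto simp: \<S>_def subset_chain_def)
    ultimately have "subring_of_field (\<Union>\<C>)"
      using \<C>(1) unfolding subring_of_field_iff by (meson UnionI ex_in_conv)
    then show "\<Union>\<C> \<in> \<S>"
      using \<C> \<open>\<And>Y. Y \<in> \<C> \<Longrightarrow> B \<subseteq> Y\<close> \<open>\<And>Y. Y \<in> \<C> \<Longrightarrow> t \<notin> Y\<close> by (auto simp: \<S>_def)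
  qed
  then obtain S where S: "subring_of_field S" "B \<subseteq> S" "t \<notin> S"
    and max: "\<And>R. subring_of_field R \<Longrightarrow> S \<subseteq> R \<Longrightarrow> t \<notin> R \<Longrightarrow> R = S"
    unfolding \<S>_def by (smt (verit) mem_Collect_eq subset_trans)
  note cl = subring_closed[OF S(1)]
  define z where "z = inverse t"
  have z: "z \<in> S" "z \<noteq> 0" "inverse z = t"
    using t S cl(4) by (auto simp: z_def)
  have adjoin: "\<exists>p\<in>polys_over S. poly p x * z = 1" if "x \<notin> S" for x
  proof -
    have "t \<in> ring_hull (insert x S)"
      using max[OF subring_ring_hull, of "insert x S"] ring_hull_superset[of "insert x S"] that
      by blast
    then obtain p where "p \<in> polys_over S" "t = poly p x"
      unfolding ring_hull_insert[OF S(1)] by blast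
    then show ?thesis using z by (intro bexI[of _ p]) (auto simp: z_def field_simps)
  qed
  \<comment> \<open>The maximality of \<open>S\<close> forces \<open>z\<close> into its Jacobson radical.\<close>
  have unit: "inverse (1 - z * s) \<in> S" if "s \<in> S" for s
  proof (rule ccontr)
    define r where "r = 1 - z * s"
    assume "inverse (1 - z * s) \<notin> S"
    then have r: "inverse r \<notin> S" by (simp add: r_def)
    have rS: "r \<in> S" "r \<noteq> 0" using that z cl r by (auto simp: r_def)
    obtain p where p: "p \<in> polys_over S" "poly p (inverse r) * z = 1" using adjoin[OF r] by blast
    have eq: "poly (reflect_poly p) r * z = r ^ Polynomial.degree p"
      using p(2) rS by (simp add: poly_reflect_poly_nz mult.assoc)
    have "reflect_poly p \<in> polys_over S"
      using p(1) cl(4) by (auto simp: polys_over_def coeff_reflect_poly)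
    then have w: "poly (reflect_poly p) r \<in> S" using rS poly_in_subring[OF S(1)] by blast
    \<comment> \<open>Modulo \<open>z\<close> the element \<open>r\<close> is \<open>1\<close>, so its powers cannot be multiples of \<open>z\<close>.\<close>
    have "\<exists>s'\<in>S. 1 - r ^ n = z * s'" for n
    proof (induction n)
      case (Suc n)
      then obtain s' where "s' \<in> S" "1 - r ^ n = z * s'" by blast
      have "1 - r ^ Suc n = (1 - r) + r * (1 - r ^ n)" by (simp add: algebra_simps)
      also have "\<dots> = z * (s + r * s')"
        unfolding \<open>1 - r ^ n = z * s'\<close> by (simp add: r_def algebra_simps)
      finally show ?case
        by (rule bexI) (intro cl(6) cl(3) that rS \<open>s' \<in> S\<close>)
    qed (auto intro: cl)
    then obtain s' where s': "s' \<in> S" "1 - r ^ Polynomial.degree p = z * s'" by blast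
    have "1 = z * (s' + poly (reflect_poly p) r)" using s'(2) eq by (simp add: algebra_simps)
    then have "t = s' + poly (reflect_poly p) r" using z by (metis inverse_unique mult.commute z_def)
    then show False using s' w cl S(3) by auto
  qed
  have "x \<in> S \<or> inverse x \<in> S" for x
  proof (rule ccontr)
    assume "\<not> (x \<in> S \<or> inverse x \<in> S)"
    then show False
      using adjoin[of x] adjoin[of "inverse x"] cl(4) no_two_sided_relation[OF S(1) z(1) _ unit]
        S(3) z(3) by metis
  qed
  then show ?thesis using S by (auto simp: Zar_iff)
qed

text \<open>
  If \<open>z\<close> lies in every valuation ring over \<open>B\<close>, then no valuation ring over \<open>B[1 / z]\<close> avoids \<open>z\<close>,
  hence \<open>z \<in> B[1 / z]\<close>; clearing denominators gives the monic equation.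
\<close>
lemma integral_of_mem_valuations:
  assumes B: "subring_of_field B" and z: "\<And>W. W \<in> Zar B \<Longrightarrow> z \<in> W"
  shows "\<exists>p\<in>polys_over B. Polynomial.lead_coeff p = 1 \<and> poly p z = 0"
proof (cases "z = 0")
  case True
  then show ?thesis using B
    by (intro bexI[of _ "[:0, 1:]"]) (auto simp: polys_over_pCons_iff polys_over_zero intro: subring_closed)
next
  case False
  let ?C = "ring_hull (insert (inverse z) B)"
  have "z \<in> ?C"
  proof (rule ccontr)
    assume "z \<notin> ?C"
    then obtain V where "V \<in> Zar ?C" "z \<notin> V"
      using valuation_avoiding[OF subring_ring_hull, of z "insert (inverse z) B"]
      by (auto intro: ring_hull.base)
    moreover have "B \<subseteq> ?C" using ring_hull_superset by blast
    ultimately show False using z Zar_antimono by blast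
  qed
  then obtain q where q: "q \<in> polys_over B" "z = poly q (inverse z)"
    unfolding ring_hull_insert[OF B] by blast
  let ?n = "Suc (Polynomial.degree q)"
  let ?r = "reflect_poly q"
  define p where "p = Polynomial.monom 1 ?n - ?r"
  have r: "Polynomial.degree ?r < ?n" by (simp add: degree_reflect_poly_le le_imp_less_Suc)
  have "reflect_poly q \<in> polys_over B"
    using q(1) subring_zero[OF B] by (auto simp: polys_over_def coeff_reflect_poly)
  then have "p \<in> polys_over B" unfolding p_def
    by (intro polys_over_diff[OF B] polys_over_monom[OF B] subring_one[OF B])
  moreover have "Polynomial.lead_coeff p = 1"
  proof -
    have "Polynomial.degree (Polynomial.monom (1::'a) ?n) = ?n" by (simp add: Polynomial.degree_monom_eq)
    then have "Polynomial.degree p = ?n" unfolding p_def diff_conv_add_uminus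
      using r by (subst Polynomial.degree_add_eq_left) auto
    then show ?thesis using r by (simp add: p_def Polynomial.coeff_eq_0)
  qed
  moreover have "poly p z = 0"
  proof -
    have "poly ?r z = z ^ Polynomial.degree q * poly q (inverse z)"
      using False by (simp add: poly_reflect_poly_nz)
    then show ?thesis using q(2) by (simp add: p_def poly_monom)
  qed
  ultimately show ?thesis by blast
qed

lemma monic_relation:
  assumes "p \<in> polys_over B" "Polynomial.lead_coeff p = 1" "poly p z = 0" "subring_of_field B"
  obtains c r where "\<And>i. c i \<in> B" "z ^ r = (\<Sum>i<r. c i * z ^ i)"
proof (rule that[of "\<lambda>i. - Polynomial.coeff p i" "Polynomial.degree p"])
  show "- Polynomial.coeff p i \<in> B" for i
    using assms subring_uminus by (auto simp: polys_over_def)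
  have "0 = (\<Sum>i<Polynomial.degree p. Polynomial.coeff p i * z ^ i) + z ^ Polynomial.degree p"
    using assms(2,3) by (simp add: poly_altdef flip: lessThan_Suc_atMost)
  then show "z ^ Polynomial.degree p = (\<Sum>i<Polynomial.degree p. - Polynomial.coeff p i * z ^ i)"
    by (simp add: sum_negf algebra_simps add_eq_0_iff)
qed

lemma valuation_integral:
  assumes W: "W \<in> Zar D" and c: "\<And>i. i < r \<Longrightarrow> c i \<in> W" and z: "z ^ r = (\<Sum>i<r. c i * z ^ i)"
  shows "z \<in> W"
proof (rule ccontr)
  assume "z \<notin> W"
  note cl = subring_closed[OF Zar_subring[OF W]]
  have v: "inverse z \<in> W" "z \<noteq> 0" using Zar_total[OF W \<open>z \<notin> W\<close>] \<open>z \<notin> W\<close> cl(4) by auto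
  have "r > 0" using z by (cases r) auto
  have "z = z ^ r * inverse z ^ (r - 1)"
    using v \<open>r > 0\<close> by (cases r) (auto simp: power_inverse field_simps)
  also have "\<dots> = (\<Sum>i<r. c i * inverse z ^ (r - 1 - i))"
    unfolding z sum_distrib_right
  proof (rule sum.cong)
    fix i assume "i \<in> {..<r}"
    then have "inverse z ^ (r - 1) = inverse z ^ i * inverse z ^ (r - 1 - i)"
      by (simp flip: power_add)
    then show "c i * z ^ i * inverse z ^ (r - 1) = c i * inverse z ^ (r - 1 - i)"
      using v by (simp add: power_inverse)
  qed simp
  also have "\<dots> \<in> W" using c v by (intro cl) auto
  finally show False using \<open>z \<notin> W\<close> by blast
qed

lemma integrally_closed_Inter_Zar:
  assumes "subring_of_field D" "quotient_field D = UNIV" "integrally_closed D"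
  shows "\<Inter>(Zar D) = D"
  using assms integral_of_mem_valuations[OF assms(1)] Zar_superset[of _ D]
  unfolding integrally_closed_def by blast

section \<open>Finitely generated rings are Noetherian\<close>

definition seq_span :: "'k::field set \<Rightarrow> (nat \<Rightarrow> 'k) \<Rightarrow> nat \<Rightarrow> 'k set" where
  "seq_span A a n = {\<Sum>m<n. c m * a m | c. \<forall>m. c m \<in> A}"

text \<open>
  The ascending chain condition for ideals, tested on the ideals generated by the initial segments of
  a sequence. Its uses below all ask for one term that is a combination of its predecessors.
\<close>
definition noetherian :: "'k::field set \<Rightarrow> bool" where
  "noetherian A \<longleftrightarrow> (\<forall>a. range a \<subseteq> A \<longrightarrow> (\<exists>n. a n \<in> seq_span A a n))"

lemma seq_span_cong: "(\<And>m. m < n \<Longrightarrow> a m = b m) \<Longrightarrow> seq_span A a n = seq_span A b n"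
  by (auto simp: seq_span_def)

context
  fixes B :: "'k::field set"
  assumes B: "subring_of_field B"
begin

lemma seq_span_zero: "0 \<in> seq_span B a n"
  unfolding seq_span_def using subring_zero[OF B] by (auto intro!: exI[of _ "\<lambda>_. 0"])

lemma seq_span_add: "x \<in> seq_span B a n \<Longrightarrow> y \<in> seq_span B a n \<Longrightarrow> x + y \<in> seq_span B a n"
proof -
  assume "x \<in> seq_span B a n" "y \<in> seq_span B a n"
  then obtain c d where "x = (\<Sum>m<n. c m * a m)" "y = (\<Sum>m<n. d m * a m)"
      "\<forall>m. c m \<in> B" "\<forall>m. d m \<in> B"
    unfolding seq_span_def by blast
  then show ?thesis unfolding seq_span_def using subring_add[OF B]
    by (intro CollectI exI[of _ "\<lambda>m. c m + d m"]) (simp add: sum.distrib algebra_simps)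
qed

lemma seq_span_mult: "b \<in> B \<Longrightarrow> x \<in> seq_span B a n \<Longrightarrow> b * x \<in> seq_span B a n"
proof -
  assume "b \<in> B" "x \<in> seq_span B a n"
  then obtain c where "x = (\<Sum>m<n. c m * a m)" "\<forall>m. c m \<in> B"
    unfolding seq_span_def by blast
  then show ?thesis unfolding seq_span_def using subring_mult[OF B] \<open>b \<in> B\<close>
    by (intro CollectI exI[of _ "\<lambda>m. b * c m"]) (simp add: sum_distrib_left mult.assoc)
qed

lemma seq_span_sum: "(\<And>i. i \<in> I \<Longrightarrow> x i \<in> seq_span B a n) \<Longrightarrow> sum x I \<in> seq_span B a n"
  by (induction I rule: infinite_finite_induct) (auto intro: seq_span_zero seq_span_add)

lemma seq_span_base: "m < n \<Longrightarrow> a m \<in> seq_span B a n"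
  unfolding seq_span_def using subring_zero[OF B] subring_one[OF B]
  by (intro CollectI exI[of _ "\<lambda>k. if k = m then 1 else 0"]) (simp add: if_distrib[of "\<lambda>x. x * _"] cong: if_cong)

lemma seq_span_subset:
  assumes "\<And>m. m < n \<Longrightarrow> a m \<in> seq_span B b k"
  shows "seq_span B a n \<subseteq> seq_span B b k"
proof
  fix x assume "x \<in> seq_span B a n"
  then obtain c where "x = (\<Sum>m<n. c m * a m)" "\<forall>m. c m \<in> B"
    unfolding seq_span_def by blast
  then show "x \<in> seq_span B b k" using assms by (auto intro!: seq_span_sum seq_span_mult)
qed

lemma seq_span_mono: "n \<le> k \<Longrightarrow> seq_span B a n \<subseteq> seq_span B a k"
  by (intro seq_span_subset seq_span_base) simp

lemma noetherian_stable:
  assumes "noetherian B" "range a \<subseteq> B"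
  shows "\<exists>N. \<forall>n\<ge>N. a n \<in> seq_span B a N"
proof (rule ccontr)
  assume "\<nexists>N. \<forall>n\<ge>N. a n \<in> seq_span B a N"
  then obtain pick where pick: "\<And>N. pick N \<ge> N" "\<And>N. a (pick N) \<notin> seq_span B a N" by metis
  define t where "t = rec_nat 0 (\<lambda>_ N. Suc (pick N))"
  have t: "t 0 = 0" "t (Suc n) = Suc (pick (t n))" for n by (simp_all add: t_def)
  have "mono t" by (rule incseq_SucI) (use pick(1)[of "t _"] in \<open>simp add: t le_SucI\<close>)
  have lt: "pick (t m) < t n" if "m < n" for m n
    using monoD[OF \<open>mono t\<close>, of "Suc m" n] that by (simp add: t)
  have "range (\<lambda>n. a (pick (t n))) \<subseteq> B" using assms(2) by blast
  then obtain n where "a (pick (t n)) \<in> seq_span B (\<lambda>n. a (pick (t n))) n"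
    using assms(1) unfolding noetherian_def by meson
  also have "\<dots> \<subseteq> seq_span B a (t n)"
    using lt by (intro seq_span_subset seq_span_base)
  finally show False using pick(2) by blast
qed

end

text \<open>
  A finite power of a Noetherian ring is a Noetherian module. From some index on, one coordinate of
  each vector is a combination of that coordinate of the first \<open>N\<close> vectors; subtracting this
  combination clears the coordinate, and the induction hypothesis handles the others.
\<close>
lemma noetherian_vectors:
  fixes A :: "'k::field set" and \<alpha> :: "nat \<Rightarrow> 'i \<Rightarrow> 'k"
  assumes A: "subring_of_field A" "noetherian A" and "finite I" and "\<And>n i. i \<in> I \<Longrightarrow> \<alpha> n i \<in> A"
  shows "\<exists>n c. (\<forall>m. c m \<in> A) \<and> (\<forall>i\<in>I. \<alpha> n i = (\<Sum>m<n. c m * \<alpha> m i))"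
  using assms(3,4)
proof (induction I arbitrary: \<alpha> rule: finite_induct)
  case empty
  show ?case by (rule exI, rule exI, rule conjI, rule allI, rule subring_zero[OF A(1)], simp)
next
  case (insert j I)
  note cl = subring_closed[OF A(1)]
  obtain N where N: "\<And>n. n \<ge> N \<Longrightarrow> \<alpha> n j \<in> seq_span A (\<lambda>n. \<alpha> n j) N"
    using noetherian_stable[OF A, of "\<lambda>n. \<alpha> n j"] insert.prems by blast
  then have "\<forall>n. \<exists>c. (\<forall>m. c m \<in> A) \<and> \<alpha> (N + n) j = (\<Sum>m<N. c m * \<alpha> m j)"
    unfolding seq_span_def by (smt (verit) le_add1 mem_Collect_eq)
  then obtain C where C: "\<And>n m. C n m \<in> A" "\<And>n. \<alpha> (N + n) j = (\<Sum>m<N. C n m * \<alpha> m j)"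
    by metis
  define \<beta> where "\<beta> n i = \<alpha> (N + n) i - (\<Sum>m<N. C n m * \<alpha> m i)" for n i
  have "\<And>n i. i \<in> I \<Longrightarrow> \<beta> n i \<in> A"
    unfolding \<beta>_def using insert.prems C by (intro cl) auto
  then obtain n c where c: "\<And>m. c m \<in> A" "\<And>i. i \<in> I \<Longrightarrow> \<beta> n i = (\<Sum>m<n. c m * \<beta> m i)"
    using insert.IH[of \<beta>] by blast
  have c2: "\<beta> n i = (\<Sum>m<n. c m * \<beta> m i)" if "i \<in> insert j I" for i
  proof (cases "i = j")
    case True
    then show ?thesis by (simp add: \<beta>_def C(2))
  qed (use that c in auto)
  define c' where "c' m = (if m < N then C n m - (\<Sum>l<n. c l * C l m) else c (m - N))" for m
  have "c' m \<in> A" for m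
    unfolding c'_def using c(1) C(1) by (auto intro!: cl)
  moreover have "\<alpha> (N + n) i = (\<Sum>m<N + n. c' m * \<alpha> m i)" if "i \<in> insert j I" for i
  proof -
    have split: "sum g {..<N + k} = sum g {..<N} + (\<Sum>l<k. g (N + l))" for g :: "nat \<Rightarrow> 'k" and k
      by (induction k) auto
    have "(\<Sum>m<N + n. c' m * \<alpha> m i)
        = (\<Sum>m<N. (C n m - (\<Sum>l<n. c l * C l m)) * \<alpha> m i) + (\<Sum>l<n. c l * \<alpha> (N + l) i)"
      by (simp add: split c'_def)
    also have "(\<Sum>m<N. (C n m - (\<Sum>l<n. c l * C l m)) * \<alpha> m i)
        = (\<Sum>m<N. C n m * \<alpha> m i) - (\<Sum>m<N. \<Sum>l<n. c l * C l m * \<alpha> m i)"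
      by (simp add: left_diff_distrib sum_subtractf sum_distrib_right)
    also have "(\<Sum>m<N. \<Sum>l<n. c l * C l m * \<alpha> m i) = (\<Sum>l<n. c l * (\<Sum>m<N. C l m * \<alpha> m i))"
      by (subst sum.swap) (simp add: sum_distrib_left mult.assoc)
    also have "(\<Sum>m<N. C n m * \<alpha> m i) - \<dots> + (\<Sum>l<n. c l * \<alpha> (N + l) i)
        = (\<Sum>m<N. C n m * \<alpha> m i) + (\<Sum>l<n. c l * \<beta> l i)"
      by (simp add: \<beta>_def right_diff_distrib sum_subtractf)
    also have "\<dots> = \<alpha> (N + n) i"
      using c2[OF that] by (simp add: \<beta>_def algebra_simps)
    finally show ?thesis by simp
  qed
  ultimately show ?case by blast
qed

text \<open>
  The prime ring is the image of the integers, so division with remainder shows that the ideal of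
  all combinations of the sequence is generated by its smallest positive multiple of \<open>1\<close>.
\<close>
lemma noetherian_prime_ring: "noetherian (ring_hull ({} :: 'k::field set))"
  unfolding noetherian_def
proof (intro allI impI)
  let ?Z = "ring_hull ({} :: 'k set)"
  fix a :: "nat \<Rightarrow> 'k"
  assume a: "range a \<subseteq> ?Z"
  note sR = subring_ring_hull[of "{} :: 'k set"]
  note sp = seq_span_zero[OF sR] seq_span_add[OF sR] seq_span_mult[OF sR] seq_span_mono[OF sR]
    seq_span_base[OF sR]
  have "?Z \<subseteq> range of_int"
  proof (rule ring_hull_least)
    show "subring_of_field (range of_int :: 'k set)"
      unfolding subring_of_field_iff
      by (auto simp flip: of_int_diff of_int_mult intro: range_eqI[of _ _ 1])
  qed simp
  with a have "\<forall>n. \<exists>k. a n = of_int k" by blast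
  then obtain b where b: "\<And>n. a n = of_int (b n)" by metis
  have int: "of_int k \<in> ?Z" for k
  proof -
    have "of_nat n \<in> ?Z" for n
      by (induction n) (auto intro: subring_closed[OF sR])
    then show ?thesis
      by (cases k rule: int_diff_cases) (auto intro: subring_closed[OF sR])
  qed
  let ?G = "\<Union>n. seq_span ?Z a n"
  show "\<exists>n. a n \<in> seq_span ?Z a n"
  proof (cases "b 0 = 0")
    case True
    then have "a 0 = 0" by (simp add: b)
    then show ?thesis using sp(1) by metis
  next
    case False
    have "a 0 \<in> seq_span ?Z a 1" using sp(5)[of 0 1 a] by auto
    then have "of_int (sgn (b 0)) * a 0 \<in> seq_span ?Z a 1" by (intro sp(3) int)
    moreover have "sgn (b 0) * b 0 = int (nat \<bar>b 0\<bar>)" by (simp add: sgn_if)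
    then have "of_int (sgn (b 0)) * a 0 = of_nat (nat \<bar>b 0\<bar>)" by (metis b of_int_mult of_int_of_nat_eq)
    ultimately have pos: "nat \<bar>b 0\<bar> > 0 \<and> of_nat (nat \<bar>b 0\<bar>) \<in> ?G" using False by auto
    define g where "g = (LEAST k. k > 0 \<and> (of_nat k :: 'k) \<in> ?G)"
    have g: "g > 0 \<and> (of_nat g :: 'k) \<in> ?G" unfolding g_def using pos by (rule LeastI)
    then obtain N where N: "(of_nat g :: 'k) \<in> seq_span ?Z a N" by auto
    define r where "r = nat (b N mod int g)"
    have r: "int r = b N mod int g" "r < g" using g by (auto simp: r_def nat_less_iff)
    have "int r = b N + (- (b N div int g)) * int g"
      by (simp add: r minus_div_mult_eq_mod[symmetric])
    then have "of_int (int r) = a N + of_int (- (b N div int g)) * of_int (int g)"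
      by (simp only: b of_int_add of_int_mult)
    then have "of_nat r = a N + of_int (- (b N div int g)) * of_nat g" by simp
    also have "\<dots> \<in> seq_span ?Z a (Suc N)"
      using N sp(4)[of N "Suc N" a] sp(5)[of N "Suc N" a] by (intro sp(2) sp(3) int) auto
    finally have "(of_nat r :: 'k) \<in> ?G" by blast
    moreover have "\<not> (r > 0 \<and> (of_nat r :: 'k) \<in> ?G)"
      using r(2) unfolding g_def by (rule not_less_Least)
    ultimately have "r = 0" by (metis not_gr_zero)
    then have "b N = (b N div int g) * int g" using r(1) by (simp add: mod_eq_0_iff_dvd)
    then have "a N = of_int (b N div int g) * of_nat g" by (metis b of_int_mult of_int_of_nat_eq)
    then show ?thesis using sp(3)[OF int N] by metis
  qed
qed

text \<open>
  Hilbert's basis theorem, stated for the ring \<open>A[z]\<close> inside \<open>K\<close> instead of for polynomials. From a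
  sequence of values without redundant terms one extracts polynomials \<open>f n\<close> of least degree whose
  value at \<open>z\<close> is not yet a combination of the previous values; a relation among leading coefficients
  would yield a polynomial of smaller degree with the same property.
\<close>
lemma noetherian_adjoin:
  fixes A :: "'k::field set"
  assumes A: "subring_of_field A" "noetherian A"
  shows "noetherian (ring_hull (insert z A))"
proof (rule ccontr)
  let ?B = "ring_hull (insert z A)"
  note cl = subring_closed[OF A(1)]
  note clB = subring_closed[OF subring_ring_hull[of "insert z A"]]
  note sR = subring_ring_hull[of "insert z A"]
  note ssp = seq_span_zero[OF sR] seq_span_add[OF sR] seq_span_mult[OF sR] seq_span_mono[OF sR]
    seq_span_base[OF sR] seq_span_subset[OF sR] seq_span_sum[OF sR]
  assume "\<not> noetherian ?B"
  then obtain g where gB: "\<And>n. g n \<in> ?B" and g: "\<And>n. g n \<notin> seq_span ?B g n"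
    unfolding noetherian_def by blast
  define G where "G = (\<Union>n. seq_span ?B g n)"
  have G0: "0 \<in> G" using ssp(1) by (auto simp: G_def)
  have Gadd: "x + y \<in> G" if xy: "x \<in> G" "y \<in> G" for x y
  proof -
    obtain n k where "x \<in> seq_span ?B g n" "y \<in> seq_span ?B g k" using xy by (auto simp: G_def)
    then have "x \<in> seq_span ?B g (max n k)" "y \<in> seq_span ?B g (max n k)"
      using ssp(4)[of n "max n k"] ssp(4)[of k "max n k"] by auto
    then have "x + y \<in> seq_span ?B g (max n k)" by (rule ssp(2))
    then show ?thesis unfolding G_def by blast
  qed
  have Gmult: "b * x \<in> G" if "b \<in> ?B" "x \<in> G" for b x
    using ssp(3)[OF that(1)] that(2) unfolding G_def by blast
  have Gsum: "(\<And>i. i \<in> I \<Longrightarrow> x i \<in> G) \<Longrightarrow> sum x I \<in> G" for I :: "nat set" and x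
    by (induction I rule: infinite_finite_induct) (auto intro: G0 Gadd)
  define Q where "Q f n = {r \<in> polys_over A. poly r z \<in> G - seq_span ?B (\<lambda>i. poly (f i) z) n}"
    for f :: "nat \<Rightarrow> 'k poly" and n
  define P where "P f n r \<longleftrightarrow>
      r \<in> Q f n \<and> (\<forall>r'\<in>Q f n. Polynomial.degree r \<le> Polynomial.degree r')" for f n r
  have "\<exists>f. \<forall>n. P f n (f n)"
  proof (rule dependent_wf_choice[OF wf_less_than])
    fix n and f f' :: "nat \<Rightarrow> 'k poly" and r
    assume "\<And>k. (k, n) \<in> less_than \<Longrightarrow> f k = f' k"
    then have "Q f n = Q f' n"
      unfolding Q_def using seq_span_cong[of n "\<lambda>i. poly (f i) z" "\<lambda>i. poly (f' i) z"] by simp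
    then show "P f n r = P f' n r" by (simp add: P_def)
  next
    fix n and f :: "nat \<Rightarrow> 'k poly"
    assume "\<And>k. (k, n) \<in> less_than \<Longrightarrow> P f k (f k)"
    then have "\<forall>k<n. \<exists>N. poly (f k) z \<in> seq_span ?B g N" by (auto simp: P_def Q_def G_def)
    then obtain \<nu> where \<nu>: "\<And>k. k < n \<Longrightarrow> poly (f k) z \<in> seq_span ?B g (\<nu> k)" by metis
    define N where "N = Max (insert 0 (\<nu> ` {..<n}))"
    have "seq_span ?B (\<lambda>i. poly (f i) z) n \<subseteq> seq_span ?B g N"
    proof (rule ssp(6))
      fix m assume "m < n"
      then have "\<nu> m \<le> N" unfolding N_def by (intro Max_ge) auto
      then show "poly (f m) z \<in> seq_span ?B g N" using \<nu>[OF \<open>m < n\<close>] ssp(4) by blast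
    qed
    moreover obtain r where "r \<in> polys_over A" "g N = poly r z"
      using gB[of N] unfolding ring_hull_insert[OF A(1)] by blast
    moreover have "g N \<in> G" using ssp(5)[of N "Suc N" g] by (auto simp: G_def)
    ultimately have "r \<in> Q f n" using g[of N] by (auto simp: Q_def)
    then show "\<exists>r. P f n r"
      unfolding P_def by (meson ex_has_least_nat[of "\<lambda>r. r \<in> Q f n" r Polynomial.degree])
  qed
  then obtain f where f: "\<And>n. f n \<in> Q f n"
    and least: "\<And>n r. r \<in> Q f n \<Longrightarrow> Polynomial.degree (f n) \<le> Polynomial.degree r"
    unfolding P_def by blast
  let ?val = "\<lambda>i. poly (f i) z"
  have fA: "f n \<in> polys_over A" for n using f by (auto simp: Q_def)
  have deg: "Polynomial.degree (f m) \<le> Polynomial.degree (f n)" if "m \<le> n" for m n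
  proof (rule least)
    show "f n \<in> Q f m" using f[of n] ssp(4)[OF that, of ?val] by (auto simp: Q_def)
  qed
  obtain N c where c: "\<And>m. c m \<in> A"
    and lc: "Polynomial.lead_coeff (f N) = (\<Sum>m<N. c m * Polynomial.lead_coeff (f m))"
  proof -
    have "range (\<lambda>n. Polynomial.lead_coeff (f n)) \<subseteq> A" using fA by (auto simp: polys_over_def)
    then show ?thesis using A(2) that unfolding noetherian_def seq_span_def by blast
  qed
  define d where "d m = Polynomial.degree (f m)" for m
  define s where "s = (\<Sum>m<N. Polynomial.monom (c m) (d N - d m) * f m)"
  have sA: "s \<in> polys_over A"
    unfolding s_def using c fA by (intro polys_over_sum polys_over_mult polys_over_monom A(1)) auto
  have pB: "poly p z \<in> ?B" if "p \<in> polys_over A" for p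
    using that unfolding ring_hull_insert[OF A(1)] by blast
  have sval: "poly s z \<in> seq_span ?B ?val N"
    unfolding s_def poly_sum poly_mult using c
    by (intro ssp(7) ssp(3) ssp(5) pB polys_over_monom A(1)) auto
  have sG: "poly s z \<in> G"
    unfolding s_def poly_sum poly_mult using c f
    by (intro Gsum Gmult pB polys_over_monom A(1)) (auto simp: Q_def)
  define f' where "f' = f N - s"
  have val: "poly f' z = poly (f N) z + (- 1) * poly s z" by (simp add: f'_def)
  have m1: "- 1 \<in> ?B" by (intro clB)
  have notin: "poly f' z \<notin> seq_span ?B ?val N"
  proof
    assume "poly f' z \<in> seq_span ?B ?val N"
    then have "poly f' z + poly s z \<in> seq_span ?B ?val N" using ssp(2) sval by blast
    then show False using f[of N] by (simp add: f'_def Q_def)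
  qed
  have "f' \<in> Q f N"
    unfolding Q_def
  proof (intro CollectI conjI DiffI notin)
    show "f' \<in> polys_over A" unfolding f'_def using fA sA by (intro polys_over_diff A(1))
    show "poly f' z \<in> G" unfolding val using f[of N] sG m1 by (intro Gadd Gmult) (auto simp: Q_def)
  qed
  then have "d N \<le> Polynomial.degree f'" using least by (simp add: d_def)
  moreover have "Polynomial.coeff s (d N) = Polynomial.lead_coeff (f N)"
    unfolding lc s_def Polynomial.coeff_sum
  proof (rule sum.cong)
    fix m assume "m \<in> {..<N}"
    then have "d m \<le> d N" using deg by (simp add: d_def)
    then show "Polynomial.coeff (Polynomial.monom (c m) (d N - d m) * f m) (d N)
        = c m * Polynomial.lead_coeff (f m)"
      by (simp add: Polynomial.coeff_monom_mult) (simp add: d_def)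
  qed simp
  then have "Polynomial.coeff f' (d N) = 0" by (simp add: f'_def d_def)
  moreover have "Polynomial.degree s \<le> d N"
    unfolding s_def
  proof (rule Polynomial.degree_sum_le)
    fix m assume "m \<in> {..<N}"
    then have "d m \<le> d N" using deg by (simp add: d_def)
    then show "Polynomial.degree (Polynomial.monom (c m) (d N - d m) * f m) \<le> d N"
      using Polynomial.degree_mult_le[of "Polynomial.monom (c m) (d N - d m)" "f m"]
        degree_monom_le[of "c m" "d N - d m"] by (simp add: d_def)
  qed simp
  then have "Polynomial.degree f' \<le> d N"
    unfolding f'_def by (intro Polynomial.degree_diff_le) (auto simp: d_def)
  ultimately have "f' = 0" by (metis eq_zero_or_degree_less leD order_antisym)
  then show False using notin ssp(1) by simp
qed

lemma noetherian_ring_hull_finite: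
  "finite F \<Longrightarrow> noetherian (ring_hull F)"
proof (induction F rule: finite_induct)
  case empty
  show ?case by (rule noetherian_prime_ring)
next
  case (insert z F)
  have "ring_hull (insert z (ring_hull F)) = ring_hull (insert z F)"
  proof
    show "ring_hull (insert z (ring_hull F)) \<subseteq> ring_hull (insert z F)"
      using ring_hull_mono[of F "insert z F"]
      by (intro ring_hull_least subring_ring_hull) (auto intro: ring_hull.base)
    show "ring_hull (insert z F) \<subseteq> ring_hull (insert z (ring_hull F))"
      by (intro ring_hull_mono) (auto intro: ring_hull.base)
  qed
  then show ?case using noetherian_adjoin[OF subring_ring_hull insert.IH] by metis
qed

section \<open>Elements with prescribed poles: one splitting condition\<close>

text \<open>
  Otherwise \<open>u\<close> would divide \<open>1\<close>. Applied to a power of a function that is \<open>1\<close> modulo \<open>u\<close>, this shows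
  that its pole after division by a higher power of \<open>u\<close> cannot be cancelled by poles of lower order.
\<close>
lemma Zar_unit:
  assumes W: "W \<in> Zar D" and "inverse u \<notin> W" and "1 - h = u * w" "w \<in> W" "u * v = h" 
  shows "v \<notin> W"
proof
  assume "v \<in> W"
  have "u \<noteq> 0" using assms(2) subring_zero[OF Zar_subring[OF W]] by auto
  moreover have "1 = u * (w + v)" using assms(3,5) by (simp add: algebra_simps)
  ultimately have "inverse u = w + v" by (metis inverse_unique)
  then show False using assms \<open>v \<in> W\<close> subring_add[OF Zar_subring[OF W]] by metis
qed

text \<open>
  Mixed products \<open>x ^ i * inverse x ^ j\<close> cancel, so \<open>R[x, 1 / x]\<close> is the sum of the modules \<open>R[x]\<close>
  and \<open>R[1 / x]\<close>.
\<close>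
lemma ring_hull_pair_split:
  assumes R: "subring_of_field R" and "x \<noteq> 0" and "z \<in> ring_hull (R \<union> {x, inverse x})"
  shows "\<exists>\<alpha>\<in>ring_hull (R \<union> {x}). \<exists>\<beta>\<in>ring_hull (R \<union> {inverse x}). z = \<alpha> + \<beta>"
proof -
  let ?P = "ring_hull (R \<union> {x})"
  let ?N = "ring_hull (R \<union> {inverse x})"
  let ?S = "{\<alpha> + \<beta> | \<alpha> \<beta>. \<alpha> \<in> ?P \<and> \<beta> \<in> ?N}"
  note clP = subring_closed[OF subring_ring_hull[of "R \<union> {x}"]]
  note clN = subring_closed[OF subring_ring_hull[of "R \<union> {inverse x}"]]
  have P: "?P = (\<lambda>p. poly p x) ` polys_over R" and N: "?N = (\<lambda>p. poly p (inverse x)) ` polys_over R"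
    using ring_hull_insert[OF R] by simp_all
  have RP: "R \<subseteq> ?P" "R \<subseteq> ?N" "x \<in> ?P" "inverse x \<in> ?N" by (auto intro: ring_hull.base)
  have Padd: "a + b \<in> ?S" if ab: "a \<in> ?P" "b \<in> ?S" for a b
  proof -
    obtain \<alpha> \<beta> where "b = \<alpha> + \<beta>" "\<alpha> \<in> ?P" "\<beta> \<in> ?N" using ab by blast
    then have "a + b = (a + \<alpha>) + \<beta>" "a + \<alpha> \<in> ?P" "\<beta> \<in> ?N" using clP(6)[OF ab(1)] by auto
    then show ?thesis by blast
  qed
  have xN: "x * b \<in> ?S" if b: "b \<in> ?N" for b
  proof -
    obtain q where q: "q \<in> polys_over R" "b = poly q (inverse x)" using b N by blast
    obtain q0 q1 where q01: "q = pCons q0 q1" by (cases q)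
    then have q0: "q0 \<in> R" and q1: "q1 \<in> polys_over R" using q(1) R by (auto simp: polys_over_pCons_iff)
    have "x * b = x * q0 + poly q1 (inverse x)" using \<open>x \<noteq> 0\<close> by (simp add: q q01 algebra_simps)
    moreover have "x * q0 \<in> ?P" using RP(1,3) q0 by (intro clP(3)) auto
    moreover have "poly q1 (inverse x) \<in> ?N" using q1 N by blast
    ultimately show ?thesis by blast
  qed
  have xS: "x * b \<in> ?S" if bS: "b \<in> ?S" for b
  proof -
    obtain \<alpha> \<beta> where b: "b = \<alpha> + \<beta>" "\<alpha> \<in> ?P" "\<beta> \<in> ?N" using bS by blast
    have "x * \<alpha> + x * \<beta> \<in> ?S" using clP(3)[OF RP(3) b(2)] xN[OF b(3)] by (rule Padd)
    then show ?thesis by (simp add: b algebra_simps)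
  qed
  have Sadd: "a + b \<in> ?S" if ab: "a \<in> ?S" "b \<in> ?S" for a b
  proof -
    obtain \<alpha> \<beta> \<alpha>' \<beta>' where "a = \<alpha> + \<beta>" "\<alpha> \<in> ?P" "\<beta> \<in> ?N" "b = \<alpha>' + \<beta>'" "\<alpha>' \<in> ?P" "\<beta>' \<in> ?N"
      using ab by blast
    then show ?thesis
      by (intro CollectI exI[of _ "\<alpha> + \<alpha>'"] exI[of _ "\<beta> + \<beta>'"] conjI clP(6) clN(6)) auto
  qed
  have PN: "poly p x * b \<in> ?S" if "p \<in> polys_over R" "b \<in> ?N" for p b
    using that(1)
  proof (induction p)
    case 0
    then show ?case using clP(4) clN(4) by force
  next
    case (pCons c p)
    then have c: "c \<in> R" and p: "p \<in> polys_over R" using R by (auto simp: polys_over_pCons_iff)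
    have "c * b \<in> ?N" using RP(2) c that(2) by (intro clN(3)) auto
    then have "c * b \<in> ?S" using clP(4) by force
    moreover have "x * (poly p x * b) \<in> ?S" using pCons.IH[OF p] by (rule xS)
    ultimately have "c * b + x * (poly p x * b) \<in> ?S" by (rule Sadd)
    then show ?case by (simp add: algebra_simps)
  qed
  have PN': "a * b \<in> ?S" if "a \<in> ?P" "b \<in> ?N" for a b
    using that(1) PN[OF _ that(2)] unfolding P by blast
  have "subring_of_field ?S"
    unfolding subring_of_field_iff
  proof (intro conjI ballI)
    show "1 \<in> ?S" using clP(1) clN(4) by force
    fix a b assume "a \<in> ?S" "b \<in> ?S"
    then obtain \<alpha> \<beta> \<alpha>' \<beta>' where ab: "a = \<alpha> + \<beta>" "\<alpha> \<in> ?P" "\<beta> \<in> ?N"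
        "b = \<alpha>' + \<beta>'" "\<alpha>' \<in> ?P" "\<beta>' \<in> ?N"
      by blast
    show "a - b \<in> ?S"
      using ab by (intro CollectI exI[of _ "\<alpha> - \<alpha>'"] exI[of _ "\<beta> - \<beta>'"] conjI clP(2) clN(2)) auto
    have "\<alpha> * \<alpha>' + \<beta> * \<beta>' \<in> ?S"
      using clP(3)[OF ab(2,5)] clN(3)[OF ab(3,6)] by blast
    then have "(\<alpha> * \<alpha>' + \<beta> * \<beta>') + (\<alpha> * \<beta>' + \<alpha>' * \<beta>) \<in> ?S"
      by (rule Sadd) (rule Sadd[OF PN'[OF ab(2,6)] PN'[OF ab(5,3)]])
    then show "a * b \<in> ?S" by (simp add: ab algebra_simps)
  qed
  moreover have "R \<union> {x, inverse x} \<subseteq> ?S"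
  proof -
    have "a \<in> ?S" if "a \<in> ?P" for a using that clN(4) by force
    moreover have "b \<in> ?S" if "b \<in> ?N" for b using that clP(4) by force
    ultimately show ?thesis using RP by blast
  qed
  ultimately have "ring_hull (R \<union> {x, inverse x}) \<subseteq> ?S" by (rule ring_hull_least)
  then show ?thesis using assms(3) by blast
qed

text \<open>
  An element integral over \<open>A[u]\<close> has, where \<open>u\<close> has a pole, at most a pole of bounded order in
  terms of \<open>u\<close>: dividing the monic equation by a high power of \<open>u\<close> turns it into an equation that is
  integral over \<open>A[1 / u]\<close>.
\<close>
lemma bounded_growth:
  assumes A: "subring_of_field A" and C: "\<And>i. C i \<in> polys_over A"
    and rel: "h ^ r = (\<Sum>i<r. poly (C i) u * h ^ i)"
  shows "\<exists>s. \<forall>W\<in>Zar A. inverse u \<in> W \<longrightarrow> h * inverse u ^ s \<in> W"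
proof -
  define s where "s = (\<Sum>i<r. Polynomial.degree (C i))"
  have "h * inverse u ^ s \<in> W" if W: "W \<in> Zar A" and v: "inverse u \<in> W" for W
  proof (cases "u = 0")
    case True
    then show ?thesis
    proof (cases "s = 0")
      case True
      have "poly (C i) u \<in> W" if "i < r" for i
      proof -
        have "Polynomial.degree (C i) = 0" using True that by (simp add: s_def)
        then obtain c where "C i = [:c:]" by (rule degree_eq_zeroE)
        then show ?thesis using C[of i] Zar_superset[OF W] by (auto simp: polys_over_pCons_iff[OF A])
      qed
      then show ?thesis using valuation_integral[OF W _ rel] True by simp
    next
      case False
      then show ?thesis using \<open>u = 0\<close> subring_zero[OF Zar_subring[OF W]] by (simp add: power_0_left)
    qed
  next
    case False
    note cl = subring_closed[OF Zar_subring[OF W]]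
    let ?v = "inverse u"
    have pv: "poly p u * ?v ^ k \<in> W" if "p \<in> polys_over A" "Polynomial.degree p \<le> k" for p k
    proof -
      have "poly p u * ?v ^ k = (\<Sum>i\<le>Polynomial.degree p. Polynomial.coeff p i * ?v ^ (k - i))"
        unfolding poly_altdef sum_distrib_right
      proof (rule sum.cong)
        fix i assume "i \<in> {..Polynomial.degree p}"
        then have "?v ^ k = ?v ^ i * ?v ^ (k - i)" using that by (simp flip: power_add)
        then show "Polynomial.coeff p i * u ^ i * ?v ^ k = Polynomial.coeff p i * ?v ^ (k - i)"
          using False by (simp add: power_inverse)
      qed simp
      also have "\<dots> \<in> W" using that Zar_superset[OF W] v by (intro cl) (auto simp: polys_over_def)
      finally show ?thesis .
    qed
    show ?thesis
    proof (rule valuation_integral[OF W])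
      show "poly (C i) u * ?v ^ (s * (r - i)) \<in> W" if "i < r" for i
      proof (rule pv)
        have "Polynomial.degree (C i) \<le> s" unfolding s_def using that by (intro member_le_sum) auto
        also have "\<dots> \<le> s * (r - i)" using that by (simp add: Suc_le_eq)
        finally show "Polynomial.degree (C i) \<le> s * (r - i)" .
      qed (rule C)
      have "(h * ?v ^ s) ^ r = (\<Sum>i<r. poly (C i) u * h ^ i) * ?v ^ (s * r)"
        by (simp add: power_mult_distrib rel flip: power_mult)
      also have "\<dots> = (\<Sum>i<r. poly (C i) u * ?v ^ (s * (r - i)) * (h * ?v ^ s) ^ i)"
        unfolding sum_distrib_right
      proof (rule sum.cong)
        fix i assume "i \<in> {..<r}"
        then have "s * r = s * (r - i) + s * i" by (simp flip: distrib_left)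
        then show "poly (C i) u * h ^ i * ?v ^ (s * r)
            = poly (C i) u * ?v ^ (s * (r - i)) * (h * ?v ^ s) ^ i"
          by (simp add: power_mult_distrib power_add power_mult)
      qed simp
      finally show "(h * ?v ^ s) ^ r = (\<Sum>i<r. poly (C i) u * ?v ^ (s * (r - i)) * (h * ?v ^ s) ^ i)" .
    qed
  qed
  then show ?thesis by blast
qed

lemma power_in_span:
  assumes B: "subring_of_field B" and c: "\<And>i. c i \<in> B" and rel: "h ^ r = (\<Sum>i<r. c i * h ^ i)"
  shows "\<exists>q. (\<forall>i. q i \<in> B) \<and> h ^ n = (\<Sum>i<r. q i * h ^ i)"
proof (induction n)
  case 0
  have "r \<noteq> 0" using rel by (intro notI) simp
  then have "h ^ 0 = (\<Sum>i<r. (if i = 0 then 1 else 0) * h ^ i)"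
    by (simp add: if_distrib[of "\<lambda>x. x * _"] cong: if_cong)
  then show ?case using subring_zero[OF B] subring_one[OF B]
    by (intro exI[of _ "\<lambda>i. if i = 0 then 1 else 0"]) simp
next
  case (Suc n)
  then obtain q where q: "\<And>i. q i \<in> B" "h ^ n = (\<Sum>i<r. q i * h ^ i)" by blast
  have "r \<noteq> 0" using rel by (intro notI) simp
  then obtain k where k: "r = Suc k" using not0_implies_Suc by blast
  define q' where "q' i = (if i = 0 then 0 else q (i - 1)) + q k * c i" for i
  have "h ^ Suc n = (\<Sum>i<k. q i * h ^ Suc i) + q k * h ^ r"
    by (simp add: q(2) k sum_distrib_left algebra_simps)
  also have "(\<Sum>i<k. q i * h ^ Suc i) = (\<Sum>i<r. (if i = 0 then 0 else q (i - 1)) * h ^ i)"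
    unfolding k sum.lessThan_Suc_shift by simp
  also have "\<dots> + q k * h ^ r = (\<Sum>i<r. q' i * h ^ i)"
    unfolding rel by (simp add: q'_def sum.distrib sum_distrib_left algebra_simps)
  finally show ?case using q c subring_closed[OF B]
    by (intro exI[of _ q']) (auto simp: q'_def)
qed

lemma subring_Inter: "(\<And>W. W \<in> \<W> \<Longrightarrow> subring_of_field W) \<Longrightarrow> subring_of_field (\<Inter>\<W>)"
  by (auto simp: subring_of_field_iff)

text \<open>
  Suppose that among the valuation rings over \<open>D\<close> with \<open>u\<close> in the maximal ideal none has \<open>x\<close> as a unit.
  They then fall into two parts: those with \<open>x\<close> in the maximal ideal, and those where \<open>x\<close> has a pole.
  The lemma finds an element \<open>f\<close> that fails to be regular exactly on the first part.

  Chevalley's theorem puts \<open>1 / u\<close> into \<open>D[u, x, 1 / x]\<close>, so \<open>1 / u = \<alpha> + \<beta>\<close> with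
  \<open>\<alpha> \<in> D[u, x]\<close> and \<open>\<beta> \<in> D[u, 1 / x]\<close>. The element \<open>h = u * \<beta> = 1 - u * \<alpha>\<close> is regular wherever \<open>u\<close>
  is; it is \<open>1\<close> modulo \<open>u\<close> on the first part and divisible by \<open>u\<close> on the second. Hence the powers of
  \<open>h / u\<close> have poles of growing order on the first part, none on the second, and further poles only
  where \<open>u\<close> has a pole. To cancel the latter, let \<open>A\<close> be a finitely generated subring of \<open>D\<close> over
  which the decomposition of \<open>1 / u\<close> still exists. As \<open>h\<close> is integral over \<open>A[u]\<close>, the
  bound on its growth shows that modulo elements regular at \<open>u\<close> (the ring \<open>E\<close>) and elements
  regular at \<open>1 / u\<close> (the ring \<open>E'\<close>) all these powers lie in one finitely generated \<open>A\<close>-module. Because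
  \<open>A\<close> is Noetherian, one power is a combination of smaller ones modulo \<open>E\<close> and \<open>E'\<close>. Up to an
  element of \<open>E\<close>, the difference lies in \<open>E'\<close>, so it has no poles where \<open>u\<close> has one, and on the
  first part the highest power dominates.

  Geometrically the first part is an effective Cartier divisor on a scheme finite over the projective
  line, and the argument is the stabilisation of the first cohomology of the multiples of this
  divisor.
\<close>
lemma separating_element:
  assumes D: "subring_of_field D" and u: "u \<noteq> 0" and x: "x \<noteq> 0"
    and sep: "\<And>W. W \<in> Zar D \<Longrightarrow> inverse u \<notin> W \<Longrightarrow> x \<notin> W \<or> inverse x \<notin> W"
  shows "\<exists>f. \<forall>W\<in>Zar D. f \<notin> W \<longleftrightarrow> inverse u \<notin> W \<and> inverse x \<notin> W"
proof -
  let ?R = "ring_hull (D \<union> {u})"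
  have DR: "D \<subseteq> ?R" "u \<in> ?R" by (auto intro: ring_hull.base)
  have "inverse u \<in> ring_hull (?R \<union> {x, inverse x})" (is "_ \<in> ?B")
  proof (rule ccontr)
    assume "inverse u \<notin> ?B"
    moreover have "inverse (inverse u) \<in> ?B" using DR by (auto intro: ring_hull.base)
    ultimately obtain V where V: "V \<in> Zar ?B" "inverse u \<notin> V"
      using valuation_avoiding[OF subring_ring_hull] by blast
    have sub: "?R \<union> {x, inverse x} \<subseteq> ?B" by (rule ring_hull_superset)
    then have "V \<in> Zar D" using V(1) Zar_antimono[of D ?B] DR(1) by auto
    moreover have "x \<in> V" "inverse x \<in> V" using sub Zar_superset[OF V(1)] by auto
    ultimately show False using sep V(2) by blast
  qed
  then obtain \<alpha> \<beta> where \<alpha>\<beta>: "\<alpha> \<in> ring_hull (?R \<union> {x})" "\<beta> \<in> ring_hull (?R \<union> {inverse x})"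
      "inverse u = \<alpha> + \<beta>"
    using ring_hull_pair_split[OF subring_ring_hull x] by blast
  have flat: "ring_hull (?R \<union> {t}) \<subseteq> ring_hull (D \<union> {u, t})" for t
    using ring_hull_mono[of "D \<union> {u}" "D \<union> {u, t}"]
    by (intro ring_hull_least subring_ring_hull) (auto intro: ring_hull.base)
  obtain F1 where F1: "finite F1" "F1 \<subseteq> D" "\<alpha> \<in> ring_hull (F1 \<union> {u, x})"
    using ring_hull_finitary[of \<alpha> D "{u, x}"] \<alpha>\<beta>(1) flat by blast
  obtain F2 where F2: "finite F2" "F2 \<subseteq> D" "\<beta> \<in> ring_hull (F2 \<union> {u, inverse x})"
    using ring_hull_finitary[of \<beta> D "{u, inverse x}"] \<alpha>\<beta>(2) flat by blast
  define A where "A = ring_hull (F1 \<union> F2)"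
  have A: "subring_of_field A" "noetherian A"
    unfolding A_def using F1 F2 by (auto intro: subring_ring_hull noetherian_ring_hull_finite)
  have "A \<subseteq> D" unfolding A_def using F1 F2 by (intro ring_hull_least D) auto
  then have ZDA: "W \<in> Zar A" if "W \<in> Zar D" for W using Zar_antimono that by blast
  have FA: "F1 \<union> F2 \<subseteq> A" unfolding A_def by (rule ring_hull_superset)
  have \<alpha>W: "\<alpha> \<in> W" if "W \<in> Zar A" "u \<in> W" "x \<in> W" for W
  proof -
    have "ring_hull (F1 \<union> {u, x}) \<subseteq> W"
      using that FA Zar_superset[OF that(1)] by (intro ring_hull_least Zar_subring[OF that(1)]) auto
    then show ?thesis using F1 by blast
  qed
  have \<beta>W: "\<beta> \<in> W" if "W \<in> Zar A" "u \<in> W" "inverse x \<in> W" for W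
  proof -
    have "ring_hull (F2 \<union> {u, inverse x}) \<subseteq> W"
      using that FA Zar_superset[OF that(1)] by (intro ring_hull_least Zar_subring[OF that(1)]) auto
    then show ?thesis using F2 by blast
  qed
  define h where "h = u * \<beta>"
  have h1: "1 - h = u * \<alpha>"
  proof -
    have "1 = u * (\<alpha> + \<beta>)" using u \<alpha>\<beta>(3) by (metis right_inverse)
    then show ?thesis by (simp add: h_def algebra_simps)
  qed
  have h: "h = 1 - u * \<alpha>" using h1 by (simp add: algebra_simps)
  have hW: "h \<in> W" if W: "W \<in> Zar A" "u \<in> W" for W
  proof (cases "x \<in> W")
    case True
    show ?thesis unfolding h
      using \<alpha>W[OF W True] W(2) by (intro subring_closed[OF Zar_subring[OF W(1)]])
  next
    case False
    show ?thesis unfolding h_def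
      using \<beta>W[OF W Zar_total[OF W(1) False]] W(2)
      by (intro subring_closed[OF Zar_subring[OF W(1)]])
  qed
  let ?Au = "ring_hull (insert u A)"
  have "\<exists>p\<in>polys_over ?Au. Polynomial.lead_coeff p = 1 \<and> poly p h = 0"
  proof (rule integral_of_mem_valuations[OF subring_ring_hull])
    fix W assume "W \<in> Zar ?Au"
    then have "W \<in> Zar A" "u \<in> W" using ring_hull_superset[of "insert u A"] by (auto simp: Zar_iff)
    then show "h \<in> W" by (rule hW)
  qed
  then obtain c r where c: "\<And>i. c i \<in> ?Au" and rel: "h ^ r = (\<Sum>i<r. c i * h ^ i)"
    using monic_relation[OF _ _ _ subring_ring_hull] by metis
  have "\<forall>i. \<exists>p\<in>polys_over A. c i = poly p u" using c unfolding ring_hull_insert[OF A(1)] by blast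
  then obtain C where C: "\<And>i. C i \<in> polys_over A" "\<And>i. c i = poly (C i) u" by metis
  have "h ^ r = (\<Sum>i<r. poly (C i) u * h ^ i)" using rel by (simp add: C(2))
  then obtain s where s: "\<And>W. W \<in> Zar A \<Longrightarrow> inverse u \<in> W \<Longrightarrow> h * inverse u ^ s \<in> W"
    using bounded_growth[OF A(1), of C h r u] C(1) by blast
  define E where "E = \<Inter>{W \<in> Zar A. u \<in> W}"
  define E' where "E' = \<Inter>{W \<in> Zar A. inverse u \<in> W}"
  have sub: "subring_of_field (\<Inter>{W \<in> Zar A. P W})" for P
    by (rule subring_Inter) (blast intro: Zar_subring)
  have sup: "A \<subseteq> \<Inter>{W \<in> Zar A. P W}" for P
    by (rule Inter_greatest) (blast dest: Zar_superset)
  have E: "subring_of_field E" "A \<subseteq> E" and E': "subring_of_field E'" "A \<subseteq> E'"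
    unfolding E_def E'_def by (rule sub sup)+
  have uE: "u \<in> E" "h \<in> E" and uE': "inverse u \<in> E'" "h * inverse u ^ s \<in> E'"
    using hW s by (auto simp: E_def E'_def)
  define I where "I = {..<s * r} \<times> {..<r}"
  define b where "b = (\<lambda>(k, i). inverse u ^ k * h ^ i)"
  \<comment> \<open>The powers of \<open>h / u\<close> all lie in \<open>Y\<close>, and \<open>I\<close> indexes finitely many generators modulo \<open>E + E'\<close>.\<close>
  define Y where "Y = {e + e' + (\<Sum>j\<in>I. a j * b j) | e e' a. e \<in> E \<and> e' \<in> E' \<and> (\<forall>j. a j \<in> A)}"
  note clA = subring_closed[OF A(1)] and clE = subring_closed[OF E(1)] and clE' = subring_closed[OF E'(1)]
  have finI: "finite I" by (simp add: I_def)
  have YI: "e + e' + (\<Sum>j\<in>I. a j * b j) \<in> Y" if "e \<in> E" "e' \<in> E'" "\<And>j. a j \<in> A" for e e' a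
    using that unfolding Y_def by blast
  have Yadd: "y + z \<in> Y" if yz: "y \<in> Y" "z \<in> Y" for y z
  proof -
    obtain e e' a d d' a' where *: "y = e + e' + (\<Sum>j\<in>I. a j * b j)" "e \<in> E" "e' \<in> E'" "\<And>j. a j \<in> A"
      "z = d + d' + (\<Sum>j\<in>I. a' j * b j)" "d \<in> E" "d' \<in> E'" "\<And>j. a' j \<in> A"
      using yz unfolding Y_def by blast
    have "(e + d) + (e' + d') + (\<Sum>j\<in>I. (a j + a' j) * b j) \<in> Y"
      by (intro YI clA(6) clE(6) clE'(6) *)
    then show ?thesis by (simp add: * sum.distrib algebra_simps)
  qed
  have Ymult: "g * y \<in> Y" if yz: "g \<in> A" "y \<in> Y" for g y
  proof -
    obtain e e' a where *: "y = e + e' + (\<Sum>j\<in>I. a j * b j)" "e \<in> E" "e' \<in> E'" "\<And>j. a j \<in> A"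
      using yz unfolding Y_def by blast
    have "g * e + g * e' + (\<Sum>j\<in>I. g * a j * b j) \<in> Y"
      using yz(1) E(2) E'(2) by (intro YI clA(3) clE(3) clE'(3) *) auto
    then show ?thesis by (simp add: * sum_distrib_left algebra_simps)
  qed
  have EY: "e \<in> Y" if "e \<in> E" for e using YI[OF that clE'(4), of "\<lambda>_. 0"] clA(4) by simp
  have EY': "e \<in> Y" if "e \<in> E'" for e using YI[OF clE(4) that, of "\<lambda>_. 0"] clA(4) by simp
  have Ysum: "(\<And>i. i \<in> J \<Longrightarrow> y i \<in> Y) \<Longrightarrow> sum y J \<in> Y" for J :: "nat set" and y
    by (induction J rule: infinite_finite_induct) (auto intro: EY clE(4) Yadd)
  have Ypow: "inverse u ^ k * h ^ i \<in> Y" if "i < r" for k i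
  proof (cases "k < s * r")
    case True
    then have "(k, i) \<in> I" using that by (simp add: I_def)
    then have "(\<Sum>j\<in>I. (if j = (k, i) then 1 else 0) * b j) = inverse u ^ k * h ^ i"
      using finI by (simp add: if_distrib[of "\<lambda>x. x * _"] b_def cong: if_cong)
    moreover have "0 + 0 + (\<Sum>j\<in>I. (if j = (k, i) then 1 else 0) * b j) \<in> Y"
      using clA(1,4) clE(4) clE'(4) by (intro YI) auto
    ultimately show ?thesis by simp
  next
    case False
    have "s * i \<le> s * r" using that by simp
    then have "k = s * i + (k - s * i)" using False by linarith
    then have "inverse u ^ k = (inverse u ^ s) ^ i * inverse u ^ (k - s * i)"
      by (metis power_add power_mult)
    then have "inverse u ^ k * h ^ i = (h * inverse u ^ s) ^ i * inverse u ^ (k - s * i)"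
      by (simp add: power_mult_distrib mult_ac)
    also have "\<dots> \<in> E'" by (rule clE'(3)[OF clE'(8)[OF uE'(2)] clE'(8)[OF uE'(1)]])
    finally show ?thesis by (rule EY')
  qed
  have Ypow2: "u ^ j * inverse u ^ k * h ^ i \<in> Y" if "i < r" for j k i
  proof (cases "k \<le> j")
    case True
    then have "u ^ j * inverse u ^ k = u ^ (j - k)"
      using u by (simp add: power_diff power_inverse divide_inverse)
    then have "u ^ j * inverse u ^ k * h ^ i = u ^ (j - k) * h ^ i" by simp
    also have "\<dots> \<in> E" using uE by (intro clE(3) clE(8))
    finally show ?thesis by (rule EY)
  next
    case False
    then have "inverse u ^ k = inverse u ^ j * inverse u ^ (k - j)" by (simp flip: power_add)
    then have "u ^ j * inverse u ^ k = inverse u ^ (k - j)"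
      using u by (simp add: power_inverse)
    then show ?thesis using Ypow[OF that] by simp
  qed
  \<comment> \<open>The exponents start at \<open>1\<close>, so that the \<open>n\<close>-th term has a pole even for \<open>n = 0\<close>.\<close>
  define g where "g n = (h * inverse u) ^ Suc n" for n
  have "g n \<in> Y" for n
  proof -
    obtain q where q: "\<And>i. q i \<in> ?Au" "h ^ Suc n = (\<Sum>i<r. q i * h ^ i)"
      using power_in_span[OF subring_ring_hull c rel] by blast
    have "g n = (\<Sum>i<r. q i * (inverse u ^ Suc n * h ^ i))"
      unfolding g_def power_mult_distrib q(2)
      by (simp only: sum_distrib_left sum_distrib_right mult_ac)
    also have "\<dots> \<in> Y"
    proof (rule Ysum)
      fix i assume i: "i \<in> {..<r}"
      obtain p where p: "p \<in> polys_over A" "q i = poly p u"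
        using q(1)[of i] unfolding ring_hull_insert[OF A(1)] by blast
      have "q i * (inverse u ^ Suc n * h ^ i)
          = (\<Sum>j\<le>Polynomial.degree p. Polynomial.coeff p j * (u ^ j * inverse u ^ Suc n * h ^ i))"
        unfolding p(2) poly_altdef
        by (simp only: sum_distrib_left sum_distrib_right mult_ac)
      also have "\<dots> \<in> Y"
        using i p(1) by (intro Ysum Ymult Ypow2) (auto simp: polys_over_def)
      finally show "q i * (inverse u ^ Suc n * h ^ i) \<in> Y" .
    qed
    finally show ?thesis .
  qed
  then have "\<forall>n. \<exists>e e' a. g n = e + e' + (\<Sum>j\<in>I. a j * b j) \<and> e \<in> E \<and> e' \<in> E' \<and> (\<forall>j. a j \<in> A)"
    unfolding Y_def by blast
  then obtain e e' a where g: "\<And>n. g n = e n + e' n + (\<Sum>j\<in>I. a n j * b j)"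
    and e: "\<And>n. e n \<in> E" and e': "\<And>n. e' n \<in> E'" and a: "\<And>n j. a n j \<in> A"
    by metis
  obtain n d where d: "\<And>m. d m \<in> A" "\<And>j. j \<in> I \<Longrightarrow> a n j = (\<Sum>m<n. d m * a m j)"
    using noetherian_vectors[OF A finI, of a] a by blast
  define f where "f = e' n - (\<Sum>m<n. d m * e' m)"
  define e0 where "e0 = e n - (\<Sum>m<n. d m * e m)"
  have f: "f + e0 = g n - (\<Sum>m<n. d m * g m)"
  proof -
    have "(\<Sum>m<n. d m * g m) = (\<Sum>m<n. d m * e m) + (\<Sum>m<n. d m * e' m)
        + (\<Sum>m<n. \<Sum>j\<in>I. d m * a m j * b j)"
      by (simp add: g algebra_simps sum.distrib sum_distrib_left)
    also have "(\<Sum>m<n. \<Sum>j\<in>I. d m * a m j * b j) = (\<Sum>j\<in>I. a n j * b j)"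
      by (subst sum.swap) (simp add: d(2) sum_distrib_right)
    finally show ?thesis by (simp add: f_def e0_def g)
  qed
  have fE': "f \<in> E'" unfolding f_def using e' d(1) E'(2) by (intro clE') auto
  have e0: "e0 \<in> E" unfolding e0_def using e d(1) E(2) by (intro clE) auto
  have "f \<notin> W \<longleftrightarrow> inverse u \<notin> W \<and> inverse x \<notin> W" if "W \<in> Zar D" for W
  proof -
    have W: "W \<in> Zar A" using ZDA that .
    note cl = subring_closed[OF Zar_subring[OF W]]
    have dW: "d m \<in> W" for m using d(1) Zar_superset[OF W] by blast
    show ?thesis
    proof (intro iffI conjI)
      assume "f \<notin> W"
      then show "inverse u \<notin> W" using fE' W by (auto simp: E'_def)
      then have uW: "u \<in> W" using Zar_total[OF W, of "inverse u"] by auto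
      show "inverse x \<notin> W"
      proof
        assume "inverse x \<in> W"
        then have "\<beta> \<in> W" using \<beta>W[OF W uW] by blast
        moreover have "h * inverse u = \<beta>" using u by (simp add: h_def)
        ultimately have gW: "g m \<in> W" for m unfolding g_def by (intro cl(8)) simp
        have "e0 \<in> W" using e0 W uW by (auto simp: E_def)
        moreover have "f = g n - (\<Sum>m<n. d m * g m) - e0" using f by (simp add: algebra_simps)
        ultimately have "f \<in> W" using gW dW by (metis (no_types, lifting) cl(2,3,7))
        then show False using \<open>f \<notin> W\<close> by blast
      qed
    next
      assume inv: "inverse u \<notin> W \<and> inverse x \<notin> W"
      then have uW: "u \<in> W" and xW: "x \<in> W"
        using Zar_total[OF W, of "inverse u"] Zar_total[OF W, of "inverse x"] by auto
      have hw: "h \<in> W" and \<alpha>w: "\<alpha> \<in> W" using hW[OF W uW] \<alpha>W[OF W uW xW] .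
      show "f \<notin> W"
      proof
        assume "f \<in> W"
        have e0W: "e0 \<in> W" using e0 W uW by (auto simp: E_def)
        define v where "v = (\<Sum>m<n. d m * (u ^ (n - Suc m) * h ^ Suc m)) + u ^ n * (f + e0)"
        have "v \<in> W" unfolding v_def using \<open>f \<in> W\<close> e0W dW uW hw by (intro cl)
        have uh: "u * (h * inverse u) = h" using u by simp
        have ug: "u ^ Suc n * g m = u * (u ^ (n - Suc m) * h ^ Suc m)" if "m < n" for m
        proof -
          have "Suc n = Suc m + Suc (n - Suc m)" using that by simp
          then have "u ^ Suc n = u ^ Suc m * u ^ Suc (n - Suc m)" by (metis power_add)
          then have "u ^ Suc n * g m = (u * (h * inverse u)) ^ Suc m * u ^ Suc (n - Suc m)"
            unfolding g_def power_mult_distrib by (simp only: mult_ac)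
          then show ?thesis unfolding uh by (simp add: mult_ac)
        qed
        have "u ^ Suc n * g n = h ^ Suc n"
          unfolding g_def power_mult_distrib[symmetric] uh ..
        then have "h ^ Suc n = u ^ Suc n * ((\<Sum>m<n. d m * g m) + (f + e0))"
          unfolding f by simp
        also have "\<dots> = (\<Sum>m<n. d m * (u ^ Suc n * g m)) + u ^ Suc n * (f + e0)"
          by (simp only: distrib_left sum_distrib_left mult.left_commute)
        also have "(\<Sum>m<n. d m * (u ^ Suc n * g m)) = (\<Sum>m<n. u * (d m * (u ^ (n - Suc m) * h ^ Suc m)))"
          by (intro sum.cong refl) (simp only: ug lessThan_iff mult.left_commute)
        also have "\<dots> + u ^ Suc n * (f + e0) = u * v"
          unfolding v_def by (simp add: distrib_left sum_distrib_left mult_ac)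
        finally have uv: "u * v = h ^ Suc n" by simp
        have "\<exists>w\<in>W. 1 - h ^ k = u * w" for k
        proof (induction k)
          case 0
          show ?case using cl(4) by (intro bexI[of _ 0]) auto
        next
          case (Suc k)
          then obtain w where w: "w \<in> W" "1 - h ^ k = u * w" by blast
          have "1 - h ^ Suc k = (1 - h) + h * (1 - h ^ k)" by (simp add: algebra_simps)
          also have "\<dots> = u * (\<alpha> + h * w)" unfolding w(2) h1 by (simp add: algebra_simps)
          finally show ?case by (rule bexI) (intro cl(6) cl(3) \<alpha>w hw w(1))
        qed
        then obtain w where "w \<in> W" "1 - h ^ Suc n = u * w" by blast
        then show False using Zar_unit[OF W _ _ _ uv] inv \<open>v \<in> W\<close> by blast
      qed
    qed
  qed
  then show ?thesis by blast
qed

section \<open>Elements with prescribed poles: closed sets of valuation rings\<close>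

lemma poly_over_valuation_decay:
  assumes V: "subring_of_field V" and p: "p \<in> polys_over V" and y: "inverse y \<in> V" "y \<noteq> 0"
  shows "poly p y * inverse y ^ Polynomial.degree p \<in> V"
proof -
  have "reflect_poly p \<in> polys_over V"
    using p subring_zero[OF V] by (auto simp: polys_over_def coeff_reflect_poly)
  then have "poly (reflect_poly p) (inverse y) \<in> V" using V y(1) by (intro poly_in_subring)
  then show ?thesis using y(2) by (simp add: poly_reflect_poly_nz mult.commute)
qed

text \<open>
  The same conclusion for a set cut out by several conditions \<open>y \<in> W\<close> inside the locus where \<open>u\<close> is in
  the maximal ideal, provided that the set is closed under passage to smaller valuation rings. The
  conditions are removed one at a time. Over \<open>D[y]\<close> the induction hypothesis gives \<open>f1\<close>, but over \<open>D\<close>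
  it may have unwanted poles at rings \<open>W\<close> with \<open>y \<notin> W\<close>. Closedness makes \<open>1 / y\<close> lie in every prime
  ideal of such a \<open>W\<close> that contains \<open>v = 1 / f1\<close>, and by Chevalley's theorem there is a uniform exponent
  \<open>N\<close> for which \<open>v * y ^ N\<close> has a pole at all these rings. Thus \<open>x = v * y ^ N\<close> distinguishes the
  wanted poles of \<open>f1\<close> from the unwanted ones as required by \<open>separating_element\<close>.
\<close>
lemma separating_element_of_closed_set:
  assumes "subring_of_field D" and u: "u \<noteq> 0"
    and closed: "\<And>W W'. W \<in> Zar D \<Longrightarrow> W' \<in> Zar D \<Longrightarrow> W \<subseteq> W' \<Longrightarrow> inverse u \<notin> W'
                  \<Longrightarrow> set ys \<subseteq> W' \<Longrightarrow> set ys \<subseteq> W"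
  shows "\<exists>f. \<forall>W\<in>Zar D. f \<notin> W \<longleftrightarrow> inverse u \<notin> W \<and> set ys \<subseteq> W"
  using assms(1,3)
proof (induction ys arbitrary: D)
  case Nil
  show ?case by (intro exI[of _ "inverse u"]) simp
next
  case (Cons y ys)
  note D = Cons.prems(1)
  let ?D' = "ring_hull (insert y D)"
  have D': "W \<in> Zar ?D' \<longleftrightarrow> W \<in> Zar D \<and> y \<in> W" for W
    using ring_hull_superset[of "insert y D"] ring_hull_least[of W "insert y D"]
    by (auto simp: Zar_iff)
  have "\<exists>f. \<forall>W\<in>Zar ?D'. f \<notin> W \<longleftrightarrow> inverse u \<notin> W \<and> set ys \<subseteq> W"
  proof (rule Cons.IH[OF subring_ring_hull])
    fix W W' assume "W \<in> Zar ?D'" "W' \<in> Zar ?D'" "W \<subseteq> W'" "inverse u \<notin> W'" "set ys \<subseteq> W'"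
    then show "set ys \<subseteq> W" using Cons.prems(2)[of W W'] by (simp add: D')
  qed
  then obtain f1 where *: "\<forall>W\<in>Zar ?D'. f1 \<notin> W \<longleftrightarrow> inverse u \<notin> W \<and> set ys \<subseteq> W"
    by blast
  have f1: "f1 \<notin> W \<longleftrightarrow> inverse u \<notin> W \<and> set ys \<subseteq> W" if "W \<in> Zar D" "y \<in> W" for W
    using * that by (simp add: D')
  show ?case
  proof (cases "f1 = 0 \<or> y = 0")
    case True
    have zero: "0 \<in> W" if "W \<in> Zar D" for W using that by (intro subring_zero Zar_subring)
    show ?thesis
    proof (cases "y = 0")
      case True
      have "\<forall>W\<in>Zar D. f1 \<notin> W \<longleftrightarrow> inverse u \<notin> W \<and> set (y # ys) \<subseteq> W"
      proof
        fix W assume "W \<in> Zar D"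
        then show "f1 \<notin> W \<longleftrightarrow> inverse u \<notin> W \<and> set (y # ys) \<subseteq> W"
          using f1[of W] zero[of W] True by simp
      qed
      then show ?thesis by blast
    next
      case False
      then have "f1 = 0" using True by blast
      have "\<forall>W\<in>Zar D. f1 \<notin> W \<longleftrightarrow> inverse u \<notin> W \<and> set (y # ys) \<subseteq> W"
      proof
        fix W assume "W \<in> Zar D"
        then show "f1 \<notin> W \<longleftrightarrow> inverse u \<notin> W \<and> set (y # ys) \<subseteq> W"
          using f1[of W] zero[of W] \<open>f1 = 0\<close> by auto
      qed
      then show ?thesis by blast
    qed
  next
    case False
    then have nz: "f1 \<noteq> 0" "y \<noteq> 0" by auto
    define v where "v = inverse f1"
    have v: "v \<noteq> 0" "inverse v = f1" using nz by (auto simp: v_def)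
    \<comment> \<open>A valuation ring over the ring generated by these sets would bound \<open>v * y ^ k\<close> for all \<open>k\<close>.\<close>
    let ?S = "range (\<lambda>k. v * y ^ k)" and ?T = "insert (inverse y) D"
    have "y \<in> ring_hull (?S \<union> ?T)"
    proof (rule ccontr)
      assume "y \<notin> ring_hull (?S \<union> ?T)"
      moreover have "inverse y \<in> ring_hull (?S \<union> ?T)" by (auto intro: ring_hull.base)
      ultimately obtain V where V: "V \<in> Zar (ring_hull (?S \<union> ?T))" "y \<notin> V"
        using valuation_avoiding[OF subring_ring_hull] by blast
      have sub: "?S \<union> ?T \<subseteq> V" using Zar_superset[OF V(1)] ring_hull_superset[of "?S \<union> ?T"] by (rule order_trans[rotated])
      then have VD: "V \<in> Zar D" using V(1) by (auto simp: Zar_iff)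
      note sV = Zar_subring[OF VD]
      \<comment> \<open>\<open>V[y]\<close> is a larger valuation ring, at which \<open>f1\<close> has a wanted pole; closedness passes this down to \<open>V\<close>.\<close>
      let ?W = "ring_hull (insert y V)"
      have VW: "V \<subseteq> ?W" "y \<in> ?W" by (auto intro: ring_hull.base)
      have WD: "?W \<in> Zar D"
        unfolding Zar_iff
        using VW(1) Zar_superset[OF VD] Zar_total[OF VD] by (blast intro: subring_ring_hull)
      have "f1 \<notin> ?W"
      proof
        assume "f1 \<in> ?W"
        then obtain p where p: "p \<in> polys_over V" "f1 = poly p y"
          unfolding ring_hull_insert[OF sV] by blast
        let ?k = "Polynomial.degree p"
        have "f1 * inverse y ^ ?k \<in> V"
          unfolding p(2) using sub nz by (intro poly_over_valuation_decay sV p) auto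
        moreover have "v * y ^ Suc ?k \<in> V" using sub by blast
        ultimately have "f1 * inverse y ^ ?k * (v * y ^ Suc ?k) \<in> V" by (rule subring_mult[OF sV])
        also have "f1 * inverse y ^ ?k * (v * y ^ Suc ?k) = y"
          using nz by (simp add: v_def field_simps)
        finally show False using V(2) by blast
      qed
      then have "inverse u \<notin> ?W \<and> set ys \<subseteq> ?W" using f1[OF WD VW(2)] by blast
      then have "set (y # ys) \<subseteq> V" using Cons.prems(2)[OF VD WD VW(1)] VW(2) by simp
      then show False using V(2) by simp
    qed
    from ring_hull_finitary[OF this] obtain F
      where F: "finite F" "F \<subseteq> ?S" "y \<in> ring_hull (F \<union> ?T)"
      by (elim exE conjE)
    obtain J where J: "finite J" "F = (\<lambda>k. v * y ^ k) ` J"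
      using finite_subset_image[OF F(1,2)] by (elim exE conjE)
    define N where "N = Max (insert 0 J)"
    have N: "k \<le> N" if "k \<in> J" for k using that J(1) by (simp add: N_def)
    define x where "x = v * y ^ N"
    have x: "x \<noteq> 0" using v nz by (simp add: x_def)
    have xout: "x \<notin> W" if W: "W \<in> Zar D" "y \<notin> W" for W
    proof
      assume "x \<in> W"
      note sW = Zar_subring[OF W(1)]
      have iy: "inverse y \<in> W" using Zar_total[OF W] .
      have "v * y ^ k \<in> W" if "k \<in> J" for k
      proof -
        have "y ^ N = y ^ k * y ^ (N - k)" using N[OF that] by (simp flip: power_add)
        then have "v * y ^ k = x * inverse y ^ (N - k)"
          using nz by (simp add: x_def power_inverse)
        also have "\<dots> \<in> W" by (intro subring_mult[OF sW] subring_power[OF sW] iy \<open>x \<in> W\<close>)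
        finally show ?thesis .
      qed
      then have "F \<union> ?T \<subseteq> W" using J(2) iy Zar_superset[OF W(1)] by auto
      then have "y \<in> W" using ring_hull_least[OF sW] F(3) by blast
      then show False using W(2) by blast
    qed
    have xin: "inverse x \<notin> W" if W: "W \<in> Zar D" "y \<in> W" "f1 \<notin> W" for W
    proof
      assume "inverse x \<in> W"
      then have "inverse x * y ^ N \<in> W"
        using W by (intro subring_mult subring_power Zar_subring[OF W(1)])
      moreover have "inverse x * y ^ N = f1" using nz by (simp add: x_def v_def power_inverse)
      ultimately show False using W(3) by simp
    qed
    have "\<exists>f. \<forall>W\<in>Zar D. f \<notin> W \<longleftrightarrow> inverse v \<notin> W \<and> inverse x \<notin> W"
      using xin xout v(2) by (intro separating_element D v(1) x) blast
    then obtain f where f: "\<And>W. W \<in> Zar D \<Longrightarrow> f \<notin> W \<longleftrightarrow> f1 \<notin> W \<and> inverse x \<notin> W"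
      unfolding v(2) by blast
    have "f \<notin> W \<longleftrightarrow> inverse u \<notin> W \<and> set (y # ys) \<subseteq> W" if W: "W \<in> Zar D" for W
    proof (cases "y \<in> W")
      case True
      then show ?thesis using f[OF W] f1[OF W True] xin[OF W True] by auto
    next
      case False
      then have "inverse x \<in> W" using Zar_total[OF W] xout[OF W False] by blast
      then show ?thesis using f[OF W] False by auto
    qed
    then show ?thesis by blast
  qed
qed

section \<open>Gauss extensions of valuation rings\<close>

lemma ideal_ring_on_iff:
  assumes V: "subring_of_field V"
  shows "ideal I (ring_on V) \<longleftrightarrow>
    I \<subseteq> V \<and> 0 \<in> I \<and> (\<forall>x\<in>I. \<forall>y\<in>I. x + y \<in> I) \<and> (\<forall>a\<in>V. \<forall>x\<in>I. a * x \<in> I)"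
proof
  assume I: "ideal I (ring_on V)"
  show "I \<subseteq> V \<and> 0 \<in> I \<and> (\<forall>x\<in>I. \<forall>y\<in>I. x + y \<in> I) \<and> (\<forall>a\<in>V. \<forall>x\<in>I. a * x \<in> I)"
    using additive_subgroup.a_subset[OF ideal.axioms(1)[OF I]]
      additive_subgroup.zero_closed[OF ideal.axioms(1)[OF I]]
      additive_subgroup.a_closed[OF ideal.axioms(1)[OF I]] ideal.I_l_closed[OF I]
    by (auto simp: ring_of_type_algebra_def)
next
  assume I: "I \<subseteq> V \<and> 0 \<in> I \<and> (\<forall>x\<in>I. \<forall>y\<in>I. x + y \<in> I) \<and> (\<forall>a\<in>V. \<forall>x\<in>I. a * x \<in> I)"
  interpret R: cring "ring_of_type_algebra :: 'a ring" by (rule cring_from_type_algebra)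
  have ring: "ring (ring_on V)"
    using R.subring_iff[of V] V by (simp add: ring_of_type_algebra_def)
  interpret RV: ring "ring_on V" by (rule ring)
  have right: "x * a \<in> I" if "x \<in> I" "a \<in> V" for x a
    using I that by (metis mult.commute)
  have neg: "- x \<in> I" if "x \<in> I" for x
    using I that subring_uminus[OF V subring_one[OF V]] by (metis mult_minus1)
  have ainv: "inv\<^bsub>add_monoid (ring_on V)\<^esub> x = - x" if "x \<in> I" for x
    using I that subring_uminus[OF V, of x]
    unfolding a_inv_def[symmetric]
    by (intro RV.minus_equality) (auto simp: ring_of_type_algebra_def)
  have "subgroup I (add_monoid (ring_on V))"
    using I neg ainv by (intro subgroup.intro) (auto simp: ring_of_type_algebra_def)
  then show "ideal I (ring_on V)"
    using I ring right by (intro idealI) (auto simp: ring_of_type_algebra_def)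
qed

text \<open>
  The definite description in \<open>the_maximal_ideal\<close> is meaningful for valuation rings: the nonunits form
  an ideal, since of two nonzero nonunits one divides the other.
\<close>
lemma the_maximal_ideal_valuation:
  assumes V: "V \<in> Zar D"
  shows "the_maximal_ideal V = {x \<in> V. x = 0 \<or> inverse x \<notin> V}" (is "_ = ?m")
    and "ideal (the_maximal_ideal V) (ring_on V)"
proof -
  note sV = Zar_subring[OF V]
  note cl = subring_closed[OF sV]
  have unit: "J = V" if "ideal J (ring_on V)" "x \<in> J" "inverse x \<in> V" "x \<noteq> 0" for J x
  proof -
    have J: "J \<subseteq> V" "\<And>a x. a \<in> V \<Longrightarrow> x \<in> J \<Longrightarrow> a * x \<in> J" using that(1) by (auto simp: ideal_ring_on_iff[OF sV])
    have "1 \<in> J" using J(2)[OF that(3,2)] that(4) by simp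
    then show ?thesis using J(1) J(2)[of _ 1] by auto
  qed
  have mult: "a * x \<in> ?m" if "a \<in> V" "x \<in> ?m" for a x
  proof (cases "a * x = 0")
    case False
    have eq: "inverse (a * x) * a = inverse x" using False by (simp add: field_simps)
    have "inverse (a * x) \<notin> V"
    proof
      assume "inverse (a * x) \<in> V"
      then have "inverse x \<in> V" unfolding eq[symmetric] using that(1) by (rule cl(3))
      then show False using that(2) False by auto
    qed
    then show ?thesis using that cl(3) by auto
  qed (use cl(4) in auto)
  have add: "x + y \<in> ?m" if xy: "x \<in> ?m" "y \<in> ?m" for x y
  proof -
    have *: "x + y \<in> ?m" if "y / x \<in> V" "x \<in> ?m" "x \<noteq> 0" for x y
    proof -
      have "x + y = (1 + y / x) * x" using that(3) by (simp add: field_simps)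
      then show ?thesis using mult[of "1 + y / x" x] that cl(1,6) by auto
    qed
    consider "x = 0" | "y = 0" | "y / x \<in> V" "x \<noteq> 0" | "x / y \<in> V" "y \<noteq> 0"
      using Zar_total[OF V, of "y / x"] by auto
    then show ?thesis
      using xy *[of y x] *[of x y] by cases (auto simp: add.commute)
  qed
  have ideal: "ideal ?m (ring_on V)"
    unfolding ideal_ring_on_iff[OF sV] using add mult cl(4) by blast
  have car: "carrier (ring_on V) = V" by simp
  have ne: "V \<noteq> ?m" using cl(1) by (metis (mono_tags, lifting) inverse_1 mem_Collect_eq zero_neq_one)
  have max: "maximalideal ?m (ring_on V)"
  proof (rule maximalidealI[OF ideal])
    show "carrier (ring_on V) \<noteq> ?m" unfolding car by (rule ne)
    fix J assume J: "ideal J (ring_on V)" "?m \<subseteq> J" "J \<subseteq> carrier (ring_on V)"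
    show "J = ?m \<or> J = carrier (ring_on V)"
    proof (cases "J \<subseteq> ?m")
      case False
      then obtain x where "x \<in> J" "x \<notin> ?m" by blast
      then have "x \<noteq> 0" "inverse x \<in> V" using J(3) by auto
      then show ?thesis using unit[OF J(1) \<open>x \<in> J\<close>] by simp
    qed (use J in blast)
  qed
  moreover have "M = ?m" if M: "maximalideal M (ring_on V)" for M
  proof -
    note idM = maximalideal.axioms(1)[OF M]
    have "M \<noteq> V" using maximalideal.I_notcarr[OF M] by auto
    then have "M \<subseteq> ?m" using unit[OF idM] idM by (auto simp: ideal_ring_on_iff[OF sV])
    then have "?m = M \<or> ?m = carrier (ring_on V)"
      by (intro maximalideal.I_maximal[OF M] ideal) auto
    then show ?thesis unfolding car using ne by blast
  qed
  ultimately show *: "the_maximal_ideal V = ?m" unfolding the_maximal_ideal_def by (intro the_equality)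
  show "ideal (the_maximal_ideal V) (ring_on V)" unfolding * by (rule ideal)
qed

lemma valuation_minimum:
  assumes V: "V \<in> Zar D" and "finite S" "\<exists>s\<in>S. s \<noteq> 0"
  shows "\<exists>s\<in>S. s \<noteq> 0 \<and> (\<forall>t\<in>S. t / s \<in> V)"
  using assms(2,3)
proof (induction S rule: finite_induct)
  case (insert x S)
  note cl = subring_closed[OF Zar_subring[OF V]]
  show ?case
  proof (cases "\<exists>s\<in>S. s \<noteq> 0")
    case True
    then obtain s where s: "s \<in> S" "s \<noteq> 0" "\<And>t. t \<in> S \<Longrightarrow> t / s \<in> V" using insert.IH by blast
    show ?thesis
    proof (cases "x / s \<in> V")
      case True
      then show ?thesis using s by (intro bexI[of _ s]) auto
    next
      case False
      then have x: "x \<noteq> 0" "s / x \<in> V" using Zar_total[OF V False] cl(4) by auto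
      have "t / x \<in> V" if "t \<in> insert x S" for t
      proof (cases "t = x")
        case True
        then show ?thesis using x cl(1) by simp
      next
        case False
        then have "(t / s) * (s / x) \<in> V" using that s(3) x(2) by (intro cl(3)) auto
        then show ?thesis using s(2) by simp
      qed
      then show ?thesis using x by (intro bexI[of _ x]) auto
    qed
  next
    case False
    then have "x \<noteq> 0" using insert.prems by auto
    moreover have "t / x \<in> V" if "t \<in> insert x S" for t
      using that False \<open>x \<noteq> 0\<close> cl(1,4) by (cases "t = x") auto
    ultimately show ?thesis by blast
  qed
qed simp

lemma content_generator:
  assumes V: "V \<in> Zar D" and "f \<noteq> 0"
  shows "\<exists>j. Polynomial.coeff f j \<noteq> 0 \<and> (\<forall>i. Polynomial.coeff f i / Polynomial.coeff f j \<in> V)"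
proof -
  let ?S = "Polynomial.coeff f ` {..Polynomial.degree f}"
  have "\<exists>s\<in>?S. s \<noteq> 0" using \<open>f \<noteq> 0\<close> by (intro bexI[of _ "Polynomial.lead_coeff f"]) auto
  then obtain s where s: "s \<in> ?S" "s \<noteq> 0" "\<And>t. t \<in> ?S \<Longrightarrow> t / s \<in> V"
    using valuation_minimum[OF V, of ?S] by blast
  have "Polynomial.coeff f i / s \<in> V" for i
  proof (cases "i \<le> Polynomial.degree f")
    case False
    then show ?thesis using subring_zero[OF Zar_subring[OF V]] by (simp add: Polynomial.coeff_eq_0)
  qed (use s in auto)
  then show ?thesis using s by auto
qed

lemma gauss_lemma:
  assumes V: "V \<in> Zar D" and p: "p \<in> polys_over V" "p \<notin> polys_over (the_maximal_ideal V)"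
    and q: "q \<in> polys_over V" "q \<notin> polys_over (the_maximal_ideal V)"
  shows "p * q \<notin> polys_over (the_maximal_ideal V)"
proof -
  let ?m = "the_maximal_ideal V"
  note m = the_maximal_ideal_valuation(1)[OF V]
  note cl = subring_closed[OF Zar_subring[OF V]]
  have I: "?m \<subseteq> V" "0 \<in> ?m" "\<And>x y. x \<in> ?m \<Longrightarrow> y \<in> ?m \<Longrightarrow> x + y \<in> ?m" "\<And>a x. a \<in> V \<Longrightarrow> x \<in> ?m \<Longrightarrow> a * x \<in> ?m"
    using the_maximal_ideal_valuation(2)[OF V] by (auto simp: ideal_ring_on_iff[OF Zar_subring[OF V]])
  have Isum: "(\<And>i. i \<in> J \<Longrightarrow> y i \<in> ?m) \<Longrightarrow> sum y J \<in> ?m" for J :: "nat set" and y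
    by (induction J rule: infinite_finite_induct) (auto intro: I)
  \<comment> \<open>In the coefficient of index \<open>i + j\<close> exactly one summand lies outside the maximal ideal.\<close>
  define i where "i = (LEAST i. Polynomial.coeff p i \<notin> ?m)"
  define j where "j = (LEAST j. Polynomial.coeff q j \<notin> ?m)"
  have "\<exists>i. Polynomial.coeff p i \<notin> ?m" using p(2) by (simp add: polys_over_def)
  then have i: "Polynomial.coeff p i \<notin> ?m" unfolding i_def by (rule LeastI_ex)
  have i_less: "Polynomial.coeff p k \<in> ?m" if "k < i" for k
    using not_less_Least[OF that[unfolded i_def]] by simp
  have "\<exists>j. Polynomial.coeff q j \<notin> ?m" using q(2) by (simp add: polys_over_def)
  then have j: "Polynomial.coeff q j \<notin> ?m" unfolding j_def by (rule LeastI_ex)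
  have j_less: "Polynomial.coeff q k \<in> ?m" if "k < j" for k
    using not_less_Least[OF that[unfolded j_def]] by simp
  let ?t = "\<lambda>k. Polynomial.coeff p k * Polynomial.coeff q (i + j - k)"
  let ?u = "Polynomial.coeff p i * Polynomial.coeff q j"
  have eq: "Polynomial.coeff (p * q) (i + j) = ?u + (\<Sum>k\<in>{..i + j} - {i}. ?t k)"
    unfolding Polynomial.coeff_mult by (subst sum.remove[of _ i]) auto
  have "(\<Sum>k\<in>{..i + j} - {i}. ?t k) \<in> ?m"
  proof (rule Isum)
    fix k assume k: "k \<in> {..i + j} - {i}"
    show "?t k \<in> ?m"
    proof (cases "k < i")
      case True
      then show ?thesis using I(4)[of "Polynomial.coeff q (i + j - k)" "Polynomial.coeff p k"] i_less q(1)
        by (simp add: polys_over_def mult.commute)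
    next
      case False
      then have "i + j - k < j" using k by auto
      then show ?thesis using I(4)[of "Polynomial.coeff p k"] j_less p(1) by (simp add: polys_over_def)
    qed
  qed
  moreover have "?u \<notin> ?m"
  proof -
    have "Polynomial.coeff p i \<in> V" "Polynomial.coeff q j \<in> V" using p q by (auto simp: polys_over_def)
    then show ?thesis using i j cl(3)[of "inverse (Polynomial.coeff p i)" "inverse (Polynomial.coeff q j)"]
      by (auto simp: m)
  qed
  ultimately have "Polynomial.coeff (p * q) (i + j) \<notin> ?m"
  proof -
    assume s: "(\<Sum>k\<in>{..i + j} - {i}. ?t k) \<in> ?m" and u: "?u \<notin> ?m"
    show ?thesis
    proof
      assume "Polynomial.coeff (p * q) (i + j) \<in> ?m"
      then have "Polynomial.coeff (p * q) (i + j) + (- 1) * (\<Sum>k\<in>{..i + j} - {i}. ?t k) \<in> ?m"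
        using s cl(1,5) by (intro I(3) I(4)) auto
      then show False using u unfolding eq by simp
    qed
  qed
  then show ?thesis by (auto simp: polys_over_def)
qed

text \<open>
  Membership in \<open>V(X)\<close> means that the content of \<open>f\<close> is divisible by the content of \<open>g\<close>; by
  \<open>content_generator\<close> each content is generated by a single coefficient, and Gauss's lemma makes the
  condition independent of the chosen fraction.
\<close>
lemma rational_ext_iff:
  assumes V: "V \<in> Zar D" and g: "g \<noteq> 0"
  shows "Fract f g \<in> rational_ext V \<longleftrightarrow>
    (\<exists>j. Polynomial.coeff g j \<noteq> 0 \<and> (\<forall>i. Polynomial.coeff f i / Polynomial.coeff g j \<in> V))"
    (is "_ \<longleftrightarrow> ?R")
proof -
  let ?m = "the_maximal_ideal V"
  note m = the_maximal_ideal_valuation(1)[OF V]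
  note cl = subring_closed[OF Zar_subring[OF V]]
  have prim: "smult (inverse c) p \<in> polys_over V \<and> smult (inverse c) p \<notin> polys_over ?m"
    if "c = Polynomial.coeff p j" "c \<noteq> 0" "\<And>i. Polynomial.coeff p i / c \<in> V" for p c j
  proof -
    have "Polynomial.coeff (smult (inverse c) p) j \<notin> ?m" using that cl(1) by (simp add: m)
    then show ?thesis using that(3) by (auto simp: polys_over_def divide_inverse mult.commute)
  qed
  obtain j where j: "Polynomial.coeff g j \<noteq> 0"
      "\<And>i. Polynomial.coeff g i / Polynomial.coeff g j \<in> V"
    using content_generator[OF V g] by blast
  define d where "d = Polynomial.coeff g j"
  have d: "d \<noteq> 0" "\<And>i. Polynomial.coeff g i / d \<in> V" using j by (auto simp: d_def)
  let ?g = "smult (inverse d) g"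
  have g1: "?g \<in> polys_over V" "?g \<notin> polys_over ?m" using prim[OF d_def d] by auto
  show ?thesis
  proof
    assume ?R
    then obtain k where k: "Polynomial.coeff g k \<noteq> 0"
        "\<And>i. Polynomial.coeff f i / Polynomial.coeff g k \<in> V" by blast
    have "Polynomial.coeff f i / d \<in> V" for i
    proof -
      have "(Polynomial.coeff f i / Polynomial.coeff g k) * (Polynomial.coeff g k / d) \<in> V"
        using k(2) d(2) by (intro cl(3))
      then show ?thesis using k(1) by simp
    qed
    then have "smult (inverse d) f \<in> polys_over V"
      by (simp add: polys_over_def divide_inverse mult.commute)
    moreover have "Fract f g = Fract (smult (inverse d) f) ?g"
      using d(1) g by (simp add: eq_fract)
    ultimately show "Fract f g \<in> rational_ext V" using g1 unfolding rational_ext_def by blast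
  next
    assume "Fract f g \<in> rational_ext V"
    then obtain f' g' where fg: "Fract f g = Fract f' g'" "f' \<in> polys_over V"
        "g' \<in> polys_over V" "g' \<notin> polys_over ?m"
      unfolding rational_ext_def by blast
    have "0 \<in> polys_over ?m" using cl(4) by (simp add: polys_over_def m)
    then have "g' \<noteq> 0" using fg(4) by auto
    then have eq: "f * g' = f' * g" using fg(1) g by (simp add: eq_fract)
    show ?R
    proof (cases "f = 0")
      case True
      then show ?thesis using j(1) cl(4) by auto
    next
      case False
      then obtain i where i: "Polynomial.coeff f i \<noteq> 0"
          "\<And>k. Polynomial.coeff f k / Polynomial.coeff f i \<in> V"
        using content_generator[OF V] by blast
      define c where "c = Polynomial.coeff f i"
      have c: "c \<noteq> 0" "\<And>k. Polynomial.coeff f k / c \<in> V" using i by (auto simp: c_def)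
      let ?f = "smult (inverse c) f"
      have f1: "?f \<in> polys_over V" "?f \<notin> polys_over ?m" using prim[OF c_def c] by auto
      have "c / d \<in> V"
      proof (rule ccontr)
        assume n: "c / d \<notin> V"
        \<comment> \<open>A product of two primitive polynomials would have all its coefficients in the maximal ideal.\<close>
        then have dc: "d / c \<in> ?m" using Zar_total[OF V n] c(1) d(1) by (simp add: m)
        have "inverse c = d / c * inverse d" using c(1) d(1) by (simp add: field_simps)
        moreover have "?f * g' = smult (inverse c) (f' * g)" by (simp add: eq)
        ultimately have "?f * g' = smult (d / c) (f' * ?g)" by simp
        moreover have "f' * ?g \<in> polys_over V" by (intro polys_over_mult Zar_subring[OF V] fg g1)
        moreover have "smult (d / c) q \<in> polys_over ?m" if "q \<in> polys_over V" for q
        proof -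
          have "a * (d / c) \<in> ?m" if "a \<in> V" for a
            using that dc the_maximal_ideal_valuation(2)[OF V]
            unfolding ideal_ring_on_iff[OF Zar_subring[OF V]] by blast
          then have "d / c * a \<in> ?m" if "a \<in> V" for a using that by (metis mult.commute)
          then show ?thesis using that
            unfolding polys_over_def mem_Collect_eq Polynomial.coeff_smult by blast
        qed
        ultimately show False using gauss_lemma[OF V f1 fg(3,4)] by metis
      qed
      have "Polynomial.coeff f k / d \<in> V" for k
      proof -
        have "(Polynomial.coeff f k / c) * (c / d) \<in> V" using c(2) \<open>c / d \<in> V\<close> by (rule cl(3))
        then show ?thesis using c(1) by simp
      qed
      then show ?thesis using j(1) unfolding d_def by blast
    qed
  qed
qed

text \<open>
  Thus \<open>V(X) \<inter> K = V\<close>, which turns the condition \<open>T \<inter> K = D\<close> into one on intersections of valuation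
  rings.
\<close>
lemma const_fract_in_rational_ext_iff:
  assumes V: "V \<in> Zar D"
  shows "const_fract c \<in> rational_ext V \<longleftrightarrow> c \<in> V"
proof -
  have "const_fract c = Fract [:c:] 1" by (simp add: const_fract_def to_fract_def)
  moreover have "Polynomial.coeff [:c:] i \<in> V" if "c \<in> V" for i
    using that subring_zero[OF Zar_subring[OF V]] by (cases i) auto
  moreover have "c \<in> V" if "\<And>i. Polynomial.coeff [:c:] i \<in> V" using that[of 0] by simp
  ultimately show ?thesis
    using rational_ext_iff[OF V, of 1 "[:c:]"] by (auto simp: Polynomial.coeff_1 split: if_splits)
qed

lemma Kr_contraction_iff:
  assumes D: "subring_of_field D" and \<Lambda>: "\<Lambda> \<noteq> {}" "\<Lambda> \<subseteq> Zar D"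
  shows "Kr \<Lambda> \<inter> range const_fract = const_fract ` D \<longleftrightarrow> \<Inter>\<Lambda> = D"
proof -
  have "inj const_fract" by (auto simp: inj_def const_fract_def)
  moreover have "const_fract c \<in> Kr \<Lambda> \<longleftrightarrow> c \<in> \<Inter>\<Lambda>" for c
    unfolding Kr_def using \<Lambda>(2) by (auto simp: const_fract_in_rational_ext_iff[of _ D] subset_iff)
  then have "Kr \<Lambda> \<inter> range const_fract = const_fract ` \<Inter>\<Lambda>" by blast
  ultimately show ?thesis using inj_image_eq_iff[of const_fract "\<Inter>\<Lambda>" D] by simp
qed

section \<open>Counting Kronecker function rings\<close>

text \<open>
  Shifting \<open>f\<close> by a power of \<open>X\<close> beyond the degree of \<open>g\<close> prevents any cancellation, so the content of
  the new denominator is generated by those of \<open>a g\<close> and \<open>f\<close> together. In other words, the new fraction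
  is the reciprocal of \<open>g / f + X ^ k / a\<close>; it fails to be in \<open>V(X)\<close> exactly where both \<open>f / g\<close> and
  \<open>a\<close> have a pole.
\<close>
lemma Fract_modified_in_rational_ext_iff:
  assumes V: "V \<in> Zar D" and "f \<noteq> 0" "g \<noteq> 0" "a \<noteq> 0" and k: "Polynomial.degree g < k"
  shows "Fract (smult a f) (smult a g + Polynomial.monom 1 k * f) \<in> rational_ext V
    \<longleftrightarrow> Fract f g \<in> rational_ext V \<or> a \<in> V"
proof -
  note cl = subring_closed[OF Zar_subring[OF V]]
  define G where "G = smult a g + Polynomial.monom 1 k * f"
  have G: "Polynomial.coeff G j = (if j < k then a * Polynomial.coeff g j else Polynomial.coeff f (j - k))" for j
    using k by (auto simp: G_def Polynomial.coeff_monom_mult Polynomial.coeff_eq_0)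
  have "Polynomial.coeff G (k + Polynomial.degree f) \<noteq> 0" using \<open>f \<noteq> 0\<close> by (simp add: G)
  then have "G \<noteq> 0" by auto
  show ?thesis unfolding G_def[symmetric] rational_ext_iff[OF V \<open>G \<noteq> 0\<close>] rational_ext_iff[OF V \<open>g \<noteq> 0\<close>]
  proof
    assume "\<exists>j. Polynomial.coeff G j \<noteq> 0 \<and> (\<forall>i. Polynomial.coeff (smult a f) i / Polynomial.coeff G j \<in> V)"
    then obtain j where j: "Polynomial.coeff G j \<noteq> 0"
        "\<And>i. a * Polynomial.coeff f i / Polynomial.coeff G j \<in> V" by auto
    show "(\<exists>j. Polynomial.coeff g j \<noteq> 0 \<and> (\<forall>i. Polynomial.coeff f i / Polynomial.coeff g j \<in> V)) \<or> a \<in> V"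
    proof (cases "j < k")
      case True
      then show ?thesis using j \<open>a \<noteq> 0\<close> by (auto simp: G)
    next
      case False
      then show ?thesis using j(1) j(2)[of "j - k"] by (simp add: G)
    qed
  next
    assume "(\<exists>j. Polynomial.coeff g j \<noteq> 0 \<and> (\<forall>i. Polynomial.coeff f i / Polynomial.coeff g j \<in> V)) \<or> a \<in> V"
    then show "\<exists>j. Polynomial.coeff G j \<noteq> 0 \<and> (\<forall>i. Polynomial.coeff (smult a f) i / Polynomial.coeff G j \<in> V)"
    proof
      assume "\<exists>j. Polynomial.coeff g j \<noteq> 0 \<and> (\<forall>i. Polynomial.coeff f i / Polynomial.coeff g j \<in> V)"
      then obtain j where j: "Polynomial.coeff g j \<noteq> 0" "\<And>i. Polynomial.coeff f i / Polynomial.coeff g j \<in> V"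
        by blast
      then have "j < k" using k le_degree[of g j] by linarith
      then show ?thesis using j \<open>a \<noteq> 0\<close> by (intro exI[of _ j]) (auto simp: G)
    next
      assume "a \<in> V"
      obtain j where j: "Polynomial.coeff f j \<noteq> 0" "\<And>i. Polynomial.coeff f i / Polynomial.coeff f j \<in> V"
        using content_generator[OF V \<open>f \<noteq> 0\<close>] by blast
      have "a * Polynomial.coeff f i / Polynomial.coeff f j \<in> V" for i
        using cl(3)[OF \<open>a \<in> V\<close> j(2)[of i]] by simp
      then show ?thesis using j(1) by (intro exI[of _ "k + j"]) (auto simp: G)
    qed
  qed
qed

text \<open>
  The hypotheses on \<open>S\<close> say that \<open>V\<close> is the only point of \<open>Zar D\<close> whose maximal ideal contains \<open>S\<close>.
  Taking \<open>u\<close> of least value in \<open>S\<close>, the conditions \<open>t / u \<in> W\<close> describe \<open>V\<close> among the rings with \<open>u\<close> in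
  the maximal ideal; minimality of \<open>V\<close> supplies the closedness.
\<close>
lemma separating_element_of_minimal_isolated_point:
  assumes D: "subring_of_field D" and V: "V \<in> Zar D"
    and min: "\<And>W. W \<in> Zar D \<Longrightarrow> W \<subseteq> V \<Longrightarrow> W = V"
    and S: "finite S" "s \<in> S" "s \<noteq> 0"
    and VS: "\<And>x. x \<in> S \<Longrightarrow> x \<noteq> 0 \<Longrightarrow> inverse x \<notin> V"
    and iso: "\<And>W. W \<in> Zar D \<Longrightarrow> (\<And>x. x \<in> S \<Longrightarrow> x \<noteq> 0 \<Longrightarrow> inverse x \<notin> W) \<Longrightarrow> W = V"
  shows "\<exists>f. \<forall>W\<in>Zar D. f \<notin> W \<longleftrightarrow> W = V"
proof -
  obtain u where u: "u \<in> S" "u \<noteq> 0" and uV: "\<And>t. t \<in> S \<Longrightarrow> t / u \<in> V"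
    using valuation_minimum[OF V S(1)] S(2,3) by blast
  obtain ys where ys: "set ys = (\<lambda>t. t / u) ` S"
    using finite_list[of "(\<lambda>t. t / u) ` S"] S(1) by blast
  have eq: "inverse u \<notin> W \<and> set ys \<subseteq> W \<longleftrightarrow> W = V" if W: "W \<in> Zar D" for W
  proof
    assume "W = V"
    then show "inverse u \<notin> W \<and> set ys \<subseteq> W" using uV VS[OF u] by (auto simp: ys)
  next
    assume *: "inverse u \<notin> W \<and> set ys \<subseteq> W"
    show "W = V"
    proof (rule iso[OF W])
      fix x assume x: "x \<in> S" "x \<noteq> 0"
      show "inverse x \<notin> W"
      proof
        assume "inverse x \<in> W"
        moreover have "x / u \<in> W" using * x by (auto simp: ys)
        ultimately have "inverse x * (x / u) \<in> W" by (rule subring_mult[OF Zar_subring[OF W]])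
        then show False using * x(2) by (simp add: field_simps)
      qed
    qed
  qed
  have "\<exists>f. \<forall>W\<in>Zar D. f \<notin> W \<longleftrightarrow> inverse u \<notin> W \<and> set ys \<subseteq> W"
  proof (rule separating_element_of_closed_set[OF D u(2)])
    fix W W' assume "W \<in> Zar D" "W' \<in> Zar D" "W \<subseteq> W'" "inverse u \<notin> W'" "set ys \<subseteq> W'"
    moreover from this have "W' = V" using eq[of W'] by simp
    ultimately have "W = W'" using min[of W] by simp
    then show "set ys \<subseteq> W" using \<open>set ys \<subseteq> W'\<close> by simp
  qed
  then obtain f where "\<And>W. W \<in> Zar D \<Longrightarrow> f \<notin> W \<longleftrightarrow> inverse u \<notin> W \<and> set ys \<subseteq> W" by blast
  then have "\<forall>W\<in>Zar D. f \<notin> W \<longleftrightarrow> W = V" using eq by simp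
  then show ?thesis ..
qed

text \<open>
  Assume that there are finitely many Kronecker function rings but more than one. Then
  \<open>D\<close> is the intersection of the set \<open>L\<close> of all \<open>W\<close> with \<open>\<phi> \<in> W(X)\<close>, for some \<open>\<phi>\<close> that is
  not in all the rings \<open>W(X)\<close>. Enlarging \<open>L\<close> by single points of its complement \<open>\<Gamma>\<close> gives distinct
  Kronecker function rings, so \<open>\<Gamma>\<close> is finite and a minimal element \<open>V\<close> of \<open>\<Gamma>\<close> is an isolated closed point.
  An element with a pole at \<open>V\<close> only would lie in the intersection of \<open>L\<close>, which is \<open>D\<close> and thus
  contained in \<open>V\<close>.
\<close>
lemma Kronecker_rings_unique_or_infinite:
  assumes D: "subring_of_field D" and Inter: "\<Inter>(Zar D) = D"
  shows "card (Kronecker_rings D) = 1 \<or> infinite (Kronecker_rings D)"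
proof (rule ccontr)
  assume "\<not> (card (Kronecker_rings D) = 1 \<or> infinite (Kronecker_rings D))"
  then have fin: "finite (Kronecker_rings D)" and card: "card (Kronecker_rings D) \<noteq> 1" by auto
  have KrI: "Kr \<Lambda> \<in> Kronecker_rings D" if "\<Lambda> \<noteq> {}" "\<Lambda> \<subseteq> Zar D" "\<Inter>\<Lambda> = D" for \<Lambda>
    using that Kr_contraction_iff[OF D that(1,2)] unfolding Kronecker_rings_def by blast
  have "UNIV \<in> Zar D" by (simp add: Zar_iff subring_of_field_iff)
  then have T0: "Kr (Zar D) \<in> Kronecker_rings D" using Inter by (intro KrI) auto
  have "\<exists>T\<in>Kronecker_rings D. T \<noteq> Kr (Zar D)"
  proof (rule ccontr)
    assume "\<not> ?thesis"
    then have "Kronecker_rings D = {Kr (Zar D)}" using T0 by blast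
    then show False using card by simp
  qed
  then obtain T where T: "T \<in> Kronecker_rings D" "T \<noteq> Kr (Zar D)" by blast
  from T(1) obtain \<Lambda> where \<Lambda>: "\<Lambda> \<noteq> {}" "\<Lambda> \<subseteq> Zar D" "T = Kr \<Lambda>"
      "T \<inter> range const_fract = const_fract ` D"
    unfolding Kronecker_rings_def by (elim CollectE conjE exE)
  have \<Lambda>D: "\<Inter>\<Lambda> = D" using \<Lambda>(3,4) Kr_contraction_iff[OF D \<Lambda>(1,2)] by simp
  obtain \<phi> V0 where \<phi>: "\<phi> \<in> Kr \<Lambda>" "V0 \<in> Zar D" "\<phi> \<notin> rational_ext V0"
    using \<Lambda>(2,3) T(2) unfolding Kr_def by blast
  obtain f g where fg: "\<phi> = Fract f g" "g \<noteq> 0" by (cases \<phi>) auto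
  have "f \<noteq> 0"
  proof
    assume "f = 0"
    then have "\<phi> \<in> rational_ext V0"
      unfolding fg(1) rational_ext_iff[OF \<phi>(2) fg(2)] using fg(2) subring_zero[OF Zar_subring[OF \<phi>(2)]]
      by (intro exI[of _ "Polynomial.degree g"]) simp
    then show False using \<phi>(3) by blast
  qed
  define \<Gamma> where "\<Gamma> = {W \<in> Zar D. \<phi> \<notin> rational_ext W}"
  define L where "L = Zar D - \<Gamma>"
  have L: "\<Lambda> \<subseteq> L" "L \<subseteq> Zar D" using \<Lambda>(2) \<phi>(1) by (auto simp: L_def \<Gamma>_def Kr_def)
  have LD: "\<Inter>L = D"
  proof
    show "\<Inter>L \<subseteq> D" using L(1) \<Lambda>D by blast
    show "D \<subseteq> \<Inter>L" using L(2) Zar_superset by blast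
  qed
  define \<tau> where "\<tau> V = Kr (insert V L)" for V
  have "inj_on \<tau> \<Gamma>"
  proof (rule inj_onI)
    have sub: "V' \<subseteq> V" if V: "V \<in> \<Gamma>" "V' \<in> \<Gamma>" "\<tau> V = \<tau> V'" for V V'
    proof
      fix a assume "a \<in> V'"
      show "a \<in> V"
      proof (rule ccontr)
        assume "a \<notin> V"
        have VZ: "V \<in> Zar D" "V' \<in> Zar D" using V by (auto simp: \<Gamma>_def)
        have "a \<noteq> 0" using \<open>a \<notin> V\<close> subring_zero[OF Zar_subring[OF VZ(1)]] by auto
        define k where "k = Suc (Polynomial.degree g)"
        define \<psi> where "\<psi> = Fract (smult a f) (smult a g + Polynomial.monom 1 k * f)"
        have \<psi>: "\<psi> \<in> rational_ext W \<longleftrightarrow> \<phi> \<in> rational_ext W \<or> a \<in> W" if "W \<in> Zar D" for W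
          unfolding \<psi>_def fg(1)
          by (rule Fract_modified_in_rational_ext_iff[OF that \<open>f \<noteq> 0\<close> fg(2) \<open>a \<noteq> 0\<close>]) (simp add: k_def)
        have "\<psi> \<in> \<tau> V'" unfolding \<tau>_def Kr_def
          using \<psi> VZ(2) \<open>a \<in> V'\<close> by (auto simp: L_def \<Gamma>_def)
        moreover have "\<psi> \<notin> \<tau> V" unfolding \<tau>_def Kr_def
          using \<psi>[OF VZ(1)] \<open>a \<notin> V\<close> V(1) by (auto simp: \<Gamma>_def)
        ultimately show False using V(3) by simp
      qed
    qed
    fix V V' assume "V \<in> \<Gamma>" "V' \<in> \<Gamma>" "\<tau> V = \<tau> V'"
    then show "V = V'" using sub[of V V'] sub[of V' V] by auto
  qed
  moreover have "\<tau> V \<in> Kronecker_rings D" if "V \<in> \<Gamma>" for V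
  proof -
    have VZ: "V \<in> Zar D" using that by (simp add: \<Gamma>_def)
    have "\<Inter>(insert V L) = D" using LD Zar_superset[OF VZ] by auto
    then show ?thesis unfolding \<tau>_def using L(2) VZ by (intro KrI) auto
  qed
  then have "finite (\<tau> ` \<Gamma>)" using fin by (meson finite_subset image_subsetI)
  ultimately have "finite \<Gamma>" by (rule finite_imageD[rotated])
  moreover have "\<Gamma> \<noteq> {}" using \<phi> by (auto simp: \<Gamma>_def)
  ultimately obtain V where V: "V \<in> \<Gamma>" "\<And>W. W \<in> \<Gamma> \<Longrightarrow> W \<subseteq> V \<Longrightarrow> W = V"
    using finite_has_minimal[of \<Gamma>] by metis
  have VZ: "V \<in> Zar D" and V\<phi>: "\<phi> \<notin> rational_ext V" using V(1) by (auto simp: \<Gamma>_def)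
  note sV = Zar_subring[OF VZ]
  have ext_iff: "\<phi> \<in> rational_ext W \<longleftrightarrow>
      (\<exists>j. Polynomial.coeff g j \<noteq> 0 \<and> (\<forall>i. Polynomial.coeff f i / Polynomial.coeff g j \<in> W))"
    if "W \<in> Zar D" for W
    unfolding fg(1) by (rule rational_ext_iff[OF that fg(2)])
  have min: "W = V" if "W \<in> Zar D" "W \<subseteq> V" for W
  proof (rule V(2)[OF _ that(2)])
    have "\<phi> \<notin> rational_ext W" using V\<phi> that(2) unfolding ext_iff[OF that(1)] ext_iff[OF VZ] by blast
    then show "W \<in> \<Gamma>" using that(1) by (simp add: \<Gamma>_def)
  qed
  have "\<exists>a. a \<in> W \<and> a \<notin> V" if "W \<in> \<Gamma> - {V}" for W using V(2)[of W] that by blast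
  then obtain a where a: "\<And>W. W \<in> \<Gamma> - {V} \<Longrightarrow> a W \<in> W" "\<And>W. W \<in> \<Gamma> - {V} \<Longrightarrow> a W \<notin> V" by metis
  obtain i where i: "Polynomial.coeff f i \<noteq> 0"
      "\<And>j. Polynomial.coeff f j / Polynomial.coeff f i \<in> V"
    using content_generator[OF VZ \<open>f \<noteq> 0\<close>] by blast
  \<comment> \<open>The first kind of elements cuts out a part of \<open>\<Gamma>\<close> containing \<open>V\<close>, the second kind removes the other points.\<close>
  define S where "S = (\<lambda>j. Polynomial.coeff g j / Polynomial.coeff f i) ` {..Polynomial.degree g}
      \<union> (\<lambda>W. inverse (a W)) ` (\<Gamma> - {V})"
  have coeff_S: "Polynomial.coeff g j / Polynomial.coeff f i \<in> S" if "Polynomial.coeff g j \<noteq> 0" for j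
    using that le_degree unfolding S_def by blast
  have "\<exists>z. \<forall>W\<in>Zar D. z \<notin> W \<longleftrightarrow> W = V"
  proof (rule separating_element_of_minimal_isolated_point[OF D VZ min])
    show "finite S" unfolding S_def using \<open>finite \<Gamma>\<close> by blast
    show "Polynomial.lead_coeff g / Polynomial.coeff f i \<in> S"
        "Polynomial.lead_coeff g / Polynomial.coeff f i \<noteq> 0"
      using coeff_S fg(2) i(1) by auto
  next
    fix x assume x: "x \<in> S" "x \<noteq> 0"
    then consider j where "x = Polynomial.coeff g j / Polynomial.coeff f i"
      | W where "W \<in> \<Gamma> - {V}" "x = inverse (a W)" unfolding S_def by blast
    then show "inverse x \<notin> V"
    proof cases
      case (1 j)
      then have gj: "Polynomial.coeff g j \<noteq> 0" using x(2) by auto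
      then obtain l where l: "Polynomial.coeff f l / Polynomial.coeff g j \<notin> V"
        using V\<phi> unfolding ext_iff[OF VZ] by blast
      have "Polynomial.coeff f l / Polynomial.coeff f i * inverse x \<notin> V"
        using l i(1) by (simp add: 1)
      then show ?thesis using subring_mult[OF sV i(2)] by blast
    qed (use a in auto)
  next
    fix W assume W: "W \<in> Zar D" "\<And>x. x \<in> S \<Longrightarrow> x \<noteq> 0 \<Longrightarrow> inverse x \<notin> W"
    have "\<phi> \<notin> rational_ext W"
    proof
      assume "\<phi> \<in> rational_ext W"
      then obtain j where j: "Polynomial.coeff g j \<noteq> 0" "Polynomial.coeff f i / Polynomial.coeff g j \<in> W"
        unfolding ext_iff[OF W(1)] by blast
      then show False using W(2)[OF coeff_S[OF j(1)]] i(1) by simp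
    qed
    then have "W \<in> \<Gamma>" using W(1) by (simp add: \<Gamma>_def)
    show "W = V"
    proof (rule ccontr)
      assume "W \<noteq> V"
      then have W': "W \<in> \<Gamma> - {V}" using \<open>W \<in> \<Gamma>\<close> by blast
      then have "a W \<noteq> 0" using a(2)[OF W'] subring_zero[OF sV] by auto
      moreover have "inverse (a W) \<in> S" using W' unfolding S_def by blast
      ultimately show False using W(2)[of "inverse (a W)"] a(1)[OF W'] by simp
    qed
  qed
  then obtain z where z: "\<And>W. W \<in> Zar D \<Longrightarrow> z \<notin> W \<longleftrightarrow> W = V" by blast
  have "V \<notin> L" using V(1) by (simp add: L_def)
  then have "z \<in> \<Inter>L" using z L(2) by blast
  then show False using LD z[OF VZ] Zar_superset[OF VZ] by blast
qed

theorem corollary6p2: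
  fixes D :: "'k::field set" and \<Delta> :: "'k set set"
  assumes "subring_of_field D" and "quotient_field D = UNIV"
    and "integrally_closed D" and "local_ring D"
    and "\<Delta> \<subseteq> Spec D" and "{0} \<notin> \<Delta>"
    and "pairwise (\<lambda>P Q. \<not> P \<subseteq> Q) \<Delta>"
    and "\<Inter>\<Delta> = {0}"
  shows "card (Kronecker_rings D) = 1 \<or> infinite (Kronecker_rings D)"
  using Kronecker_rings_unique_or_infinite[OF assms(1) integrally_closed_Inter_Zar[OF assms(1-3)]] .

end
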